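(* Let $M_1,M_2\in\mathbb{N}$, $M_1,M_2\ge 1$, be fixed, and consider the Störmer–Verlet numerical flows with fixed point iterations $$\Upsilon_h^{[M_1,M_2]}:=\Psi_{h/2}^{[M_2]}\circ\Phi_{h/2}^{[M_1]},\qquad \Lambda_h^{[M_1,M_2]}:=\Phi_{h/2}^{[M_2]}\circ\Psi_{h/2}^{[M_1]}$$ for the Hamiltonian $H$. Then: (i) $$(D\Upsilon_h^{[M_1,M_2]})^TJ(D\Upsilon_h^{[M_1,M_2]})=J+\begin{pmatrix}P_{11}&P_{12}\\P_{21}&P_{22}\end{pmatrix},$$ where the $N\times N$ matrices $P_{11},P_{12},P_{21}$ are of order $\mathcal{O}(h^{\min\{M_1,M_2\}+1})$ and $P_{22}$ is of order $\mathcal{O}(h^{M_2+1})$ as $h\to 0$. (ii) $$(D\Lambda_h^{[M_1,M_2]})^TJ(D\Lambda_h^{[M_1,M_2]})=J+\begin{pmatrix}P_{11}&P_{12}\\P_{21}&P_{22}\end{pmatrix}$$ (with, in general, different blocks), where $P_{12},P_{21},P_{22}$ are of order $\mathcal{O}(h^{\min\{M_1,M_2\}+1})$ and $P_{11}$ is of order $\mathcal{O}(h^{M_2+1})$ as $h\to 0$.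
   Context: Let $N\ge 1$, let $\mathcal{D}\subset\mathbb{R}^N\times\mathbb{R}^N$ be compact and convex, and let $H=H(q,p)$ be a real-valued Hamiltonian which is sufficiently smooth on $\mathcal{D}$ (all derivatives exist and are continuous; concretely, $H$ is $C^\infty$ on an open neighbourhood of $\mathcal{D}$). $H_q,H_p$ denote the gradients of $H$ with respect to $q$ and $p$. $J=\begin{pmatrix}O&I\\-I&O\end{pmatrix}\in\mathbb{R}^{2N\times 2N}$. For $M\ge 1$ and step $h>0$: - $\Phi_h^{[M]}$ ($p$-implicit Symplectic Euler with $M$ fixed point iterations): $p_0:=p$, $p_{n+1}:=p-hH_q(q,p_n)$ for $n=0,\dots,M-1$, $\tilde p:=p_M$, $\tilde q:=q+hH_p(q,\tilde p)$, $\Phi_h^{[M]}(q,p):=(\tilde q,\tilde p)$. - $\Psi_h^{[M]}$ ($q$-implicit Symplectic Euler with $M$ fixed point iterations): $q_0:=q$, $q_{n+1}:=q+hH_p(q_n,p)$ for $n=0,\dots,M-1$, $\tilde q:=q_M$, $\tilde p:=p-hH_q(\tilde q,p)$, $\Psi_h^{[M]}(q,p):=(\tilde q,\tilde p)$. $D\Theta$ denotes the $2N\times2N$ Jacobian matrix of a map $\Theta$ with respect to $(q,p)$. Standing assumption: $S\subset\mathcal{D}$ is a set of initial values and $h_0>0$ is such that for all $0<h\le h_0$ and $(q,p)\in S$ all points at which $H$ and its derivatives are evaluated in the (composed) scheme, and all intermediate and final results of the steps, lie in $\mathcal{D}$. A matrix depending on $h$ and $(q,p)$ is $\mathcal{O}(h^r)$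 if its norm is at most $Ch^r$ for all sufficiently small $h\in(0,h_0]$ and all $(q,p)\in S$, with $C$ independent of $h$ and $(q,p)$ (it may depend on $H,\mathcal{D},M_1,M_2,N$). *)

theory Defs
  imports "HOL-Analysis.Analysis"
begin

text \<open>
  Phase space is \<open>real^'n \<times> real^'n\<close> with points \<open>(q, p)\<close>, so that \<open>N = CARD('n)\<close>.
  The \<open>2N \<times> 2N\<close> matrices are indexed by \<open>'n + 'n\<close>: the indices \<open>Inl i\<close> belong to \<open>q\<close>,
  the indices \<open>Inr i\<close> to \<open>p\<close>.
\<close>

type_synonym 'n phase = "(real ^ 'n) \<times> (real ^ 'n)"

primrec Ck_on :: "nat \<Rightarrow> ('a::real_normed_vector \<Rightarrow> real) \<Rightarrow> 'a set \<Rightarrow> bool" where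
  "Ck_on 0 f U \<longleftrightarrow> continuous_on U f"
| "Ck_on (Suc k) f U \<longleftrightarrow>
     (\<forall>x\<in>U. f differentiable (at x)) \<and>
     (\<forall>v. Ck_on k (\<lambda>x. frechet_derivative f (at x) v) U)"

definition smooth_near :: "('a::real_normed_vector \<Rightarrow> real) \<Rightarrow> 'a set \<Rightarrow> bool" where
  "smooth_near f D \<longleftrightarrow> (\<exists>U. open U \<and> D \<subseteq> U \<and> (\<forall>k. Ck_on k f U))"

definition gradient :: "('a::real_inner \<Rightarrow> real) \<Rightarrow> 'a \<Rightarrow> 'a" where
  "gradient f x = (THE g. GDERIV f x :> g)"

lemma gradient_eqI:
  assumes "GDERIV f x :> g"
  shows "gradient f x = g"
  unfolding gradient_def
proof (rule the_equality)
  show "GDERIV f x :> g" by (rule assms)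
next
  fix g' assume "GDERIV f x :> g'"
  then have "(\<lambda>v. inner v g') = (\<lambda>v. inner v g)"
    using assms unfolding gderiv_def by (rule has_derivative_unique)
  then show "g' = g"
    by (metis inner_commute vector_eq_rdot)
qed

definition grad_q :: "('n phase \<Rightarrow> real) \<Rightarrow> 'n::finite phase \<Rightarrow> real ^ 'n" where
  "grad_q H z = gradient (\<lambda>x. H (x, snd z)) (fst z)"

definition grad_p :: "('n phase \<Rightarrow> real) \<Rightarrow> 'n::finite phase \<Rightarrow> real ^ 'n" where
  "grad_p H z = gradient (\<lambda>y. H (fst z, y)) (snd z)"

primrec p_iter ::
    "('n phase \<Rightarrow> real) \<Rightarrow> real \<Rightarrow> real ^ 'n::finite \<Rightarrow> real ^ 'n \<Rightarrow> nat \<Rightarrow> real ^ 'n" where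
  "p_iter H h q p 0 = p"
| "p_iter H h q p (Suc n) = p - h *\<^sub>R grad_q H (q, p_iter H h q p n)"

primrec q_iter ::
    "('n phase \<Rightarrow> real) \<Rightarrow> real \<Rightarrow> real ^ 'n::finite \<Rightarrow> real ^ 'n \<Rightarrow> nat \<Rightarrow> real ^ 'n" where
  "q_iter H h q p 0 = q"
| "q_iter H h q p (Suc n) = q + h *\<^sub>R grad_p H (q_iter H h q p n, p)"

definition Phi :: "('n phase \<Rightarrow> real) \<Rightarrow> nat \<Rightarrow> real \<Rightarrow> 'n::finite phase \<Rightarrow> 'n phase" where
  "Phi H M h = (\<lambda>(q, p).
     let p' = p_iter H h q p M in (q + h *\<^sub>R grad_p H (q, p'), p'))"

definition Psi :: "('n phase \<Rightarrow> real) \<Rightarrow> nat \<Rightarrow> real \<Rightarrow> 'n::finite phase \<Rightarrow> 'n phase" where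
  "Psi H M h = (\<lambda>(q, p).
     let q' = q_iter H h q p M in (q', p - h *\<^sub>R grad_q H (q', p)))"

definition Upsilon ::
    "('n phase \<Rightarrow> real) \<Rightarrow> nat \<Rightarrow> nat \<Rightarrow> real \<Rightarrow> 'n::finite phase \<Rightarrow> 'n phase" where
  "Upsilon H M1 M2 h = Psi H M2 (h / 2) \<circ> Phi H M1 (h / 2)"

definition Lambda ::
    "('n phase \<Rightarrow> real) \<Rightarrow> nat \<Rightarrow> nat \<Rightarrow> real \<Rightarrow> 'n::finite phase \<Rightarrow> 'n phase" where
  "Lambda H M1 M2 h = Phi H M2 (h / 2) \<circ> Psi H M1 (h / 2)"

text \<open>
  All points at which derivatives of \<open>H\<close> are evaluated during a step, and all its
  intermediate and final results, lie in \<open>D\<close>. The case \<open>n = 0\<close> is the initial value; the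
  case \<open>n = M\<close> is the point at which the second, explicit update evaluates \<open>H\<close>.
\<close>

definition Phi_stays_in ::
    "'n::finite phase set \<Rightarrow> ('n phase \<Rightarrow> real) \<Rightarrow> nat \<Rightarrow> real \<Rightarrow> 'n phase \<Rightarrow> bool" where
  "Phi_stays_in D H M h z \<longleftrightarrow>
     (\<forall>n\<le>M. (fst z, p_iter H h (fst z) (snd z) n) \<in> D) \<and> Phi H M h z \<in> D"

definition Psi_stays_in ::
    "'n::finite phase set \<Rightarrow> ('n phase \<Rightarrow> real) \<Rightarrow> nat \<Rightarrow> real \<Rightarrow> 'n phase \<Rightarrow> bool" where
  "Psi_stays_in D H M h z \<longleftrightarrow>
     (\<forall>n\<le>M. (q_iter H h (fst z) (snd z) n, snd z) \<in> D) \<and> Psi H M h z \<in> D"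

definition Upsilon_admissible ::
    "'n::finite phase set \<Rightarrow> ('n phase \<Rightarrow> real) \<Rightarrow> nat \<Rightarrow> nat \<Rightarrow> 'n phase set \<Rightarrow> real \<Rightarrow> bool" where
  "Upsilon_admissible D H M1 M2 S h0 \<longleftrightarrow>
     (\<forall>h. 0 < h \<and> h \<le> h0 \<longrightarrow> (\<forall>z\<in>S.
        Phi_stays_in D H M1 (h / 2) z \<and>
        Psi_stays_in D H M2 (h / 2) (Phi H M1 (h / 2) z)))"

definition Lambda_admissible ::
    "'n::finite phase set \<Rightarrow> ('n phase \<Rightarrow> real) \<Rightarrow> nat \<Rightarrow> nat \<Rightarrow> 'n phase set \<Rightarrow> real \<Rightarrow> bool" where
  "Lambda_admissible D H M1 M2 S h0 \<longleftrightarrow>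
     (\<forall>h. 0 < h \<and> h \<le> h0 \<longrightarrow> (\<forall>z\<in>S.
        Psi_stays_in D H M1 (h / 2) z \<and>
        Phi_stays_in D H M2 (h / 2) (Psi H M1 (h / 2) z)))"

definition vec_of_phase :: "'n::finite phase \<Rightarrow> real ^ ('n + 'n)" where
  "vec_of_phase z = (\<chi> k. case k of Inl i \<Rightarrow> fst z $ i | Inr i \<Rightarrow> snd z $ i)"

definition phase_of_vec :: "real ^ ('n + 'n) \<Rightarrow> 'n::finite phase" where
  "phase_of_vec x = (\<chi> i. x $ Inl i, \<chi> i. x $ Inr i)"

lemma phase_of_vec_of_phase [simp]: "phase_of_vec (vec_of_phase z) = z"
  by (simp add: phase_of_vec_def vec_of_phase_def vec_eq_iff prod_eq_iff)

lemma vec_of_phase_of_vec [simp]: "vec_of_phase (phase_of_vec x) = x"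
  by (auto simp: phase_of_vec_def vec_of_phase_def vec_eq_iff split: sum.split)

definition phase_jacobian ::
    "('n::finite phase \<Rightarrow> 'n phase) \<Rightarrow> 'n phase \<Rightarrow> real ^ ('n + 'n) ^ ('n + 'n)" where
  "phase_jacobian T z =
     jacobian (\<lambda>x. vec_of_phase (T (phase_of_vec x))) (at (vec_of_phase z))"

definition block_mat ::
    "real ^ 'n ^ 'n \<Rightarrow> real ^ 'n ^ 'n \<Rightarrow> real ^ 'n ^ 'n \<Rightarrow> real ^ 'n ^ 'n
      \<Rightarrow> real ^ ('n + 'n) ^ ('n::finite + 'n)" where
  "block_mat A B C E = (\<chi> i j.
     case i of
       Inl a \<Rightarrow> (case j of Inl b \<Rightarrow> A $ a $ b | Inr b \<Rightarrow> B $ a $ b)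
     | Inr a \<Rightarrow> (case j of Inl b \<Rightarrow> C $ a $ b | Inr b \<Rightarrow> E $ a $ b))"

definition J_mat :: "real ^ ('n + 'n) ^ ('n::finite + 'n)" where
  "J_mat = block_mat 0 (mat 1) (- mat 1) 0"

text \<open>
  \<open>A h z = O(h^r)\<close> as \<open>h \<rightarrow> 0\<close>, uniformly in \<open>z \<in> S\<close>, with constant \<open>C\<close>. The constant is an
  explicit argument so that one can say which data it depends on. The norm is the Frobenius norm.
\<close>

definition order_with ::
    "real \<Rightarrow> 'n phase set \<Rightarrow> real \<Rightarrow> nat \<Rightarrow> (real \<Rightarrow> 'n phase \<Rightarrow> real ^ 'n ^ 'n) \<Rightarrow> bool" where
  "order_with C S h0 r A \<longleftrightarrow>
     (\<exists>\<delta>>0. \<forall>h. 0 < h \<and> h \<le> h0 \<and> h < \<delta> \<longrightarrow> (\<forall>z\<in>S. norm (A h z) \<le> C * h ^ r))"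

end

theory Submission
  imports Defs
begin

text \<open>
Let \<open>\<omega>(u, v) = u\<^sub>q \<bullet> v\<^sub>p - u\<^sub>p \<bullet> v\<^sub>q\<close> be the canonical form, the bilinear form of \<open>J\<close>. The matrix
\<open>(DT)\<^sup>T J (DT) - J\<close> represents the defect \<open>\<omega>(T' u, T' v) - \<omega>(u, v)\<close>, and its blocks are the defects
on pairs of basis vectors in the directions of \<open>q\<close> and \<open>p\<close> (\<open>jacobian_defect_blocks\<close>). So the
theorem is an estimate of the defect of a composition of two maps.

For one \<open>p\<close>-implicit Euler step with \<open>M\<close> fixed point iterations the defect can be computed exactly.
Let \<open>r = p_(M+1) - p_M\<close> be the residual of the implicit equation. If it were zero, the step would be
the symplectic Euler method, which is symplectic; in general symmetry of the Hessian leaves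
\<open>dq' \<and> dp' = dq \<and> dp - dq \<and> dr\<close> (\<open>euler_step_defect\<close>). Each iteration gains a factor \<open>h\<close>, also after
differentiation with respect to the initial value, so \<open>dr\<close> is of order \<open>h^(M+1)\<close>
(\<open>iter_deriv_gap_bound\<close>). Hence the defect of the step is of order \<open>h^(M+1)\<close>, and since \<open>dr\<close>
is multiplied by \<open>dq\<close>, its \<open>pp\<close> block is zero.

The \<open>q\<close>-implicit step for \<open>H(q, p)\<close> is the \<open>p\<close>-implicit step for \<open>- H(p, q)\<close>, conjugated with the
exchange of \<open>q\<close> and \<open>p\<close>, so it inherits the estimate (\<open>gradient_field.dual\<close>). By the chain rule the
defect of a composition is the sum of the defect of the first map and of the defect of the second
map, evaluated on vectors transported by the derivative of the first (\<open>symplectic_defect_compose\<close>).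
This gives order \<open>min M1 M2 + 1\<close> for all blocks of the composition \<open>\<Upsilon>\<close>, and order \<open>M2 + 1\<close> for the
block in which the first defect is zero (\<open>verlet_defect_bound\<close>). The composition \<open>\<Lambda>\<close> is the
conjugate of \<open>\<Upsilon>\<close> for \<open>- H(p, q)\<close>, so the same estimate applies with \<open>q\<close> and \<open>p\<close> exchanged.
\<close>

section \<open>Commutation of mixed derivatives\<close>

text \<open>
The mean value theorem, first along \<open>v\<close> and then along \<open>w\<close>, turns the mixed second difference
of \<open>f\<close> over the parallelogram spanned by \<open>t v\<close> and \<open>t w\<close> into a mixed second derivative at an
inner point. The left-hand side is symmetric in \<open>v\<close> and \<open>w\<close>, which is what makes the order of
differentiation irrelevant in the limit.
\<close>
lemma second_difference_mean_value:
  fixes f :: "'a::real_normed_vector \<Rightarrow> real"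
  assumes t: "0 < t"
    and U: "\<And>a b. \<lbrakk>0 \<le> a; a \<le> t; 0 \<le> b; b \<le> t\<rbrakk> \<Longrightarrow> z + a *\<^sub>R v + b *\<^sub>R w \<in> U"
    and f': "\<And>x. x \<in> U \<Longrightarrow> (f has_derivative f' x) (at x)"
    and f'': "\<And>x. x \<in> U \<Longrightarrow> ((\<lambda>y. f' y v) has_derivative f'' x) (at x)"
  shows "\<exists>a b. 0 < a \<and> a < t \<and> 0 < b \<and> b < t \<and>
    f (z + t *\<^sub>R v + t *\<^sub>R w) - f (z + t *\<^sub>R v) - f (z + t *\<^sub>R w) + f z
      = t * (t * f'' (z + a *\<^sub>R v + b *\<^sub>R w) w)"
proof -
  have along_v: "((\<lambda>s. f (z + s *\<^sub>R v + b *\<^sub>R w)) has_field_derivative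
      f' (z + s *\<^sub>R v + b *\<^sub>R w) v) (at s)"
    if "0 \<le> s" "s \<le> t" "0 \<le> b" "b \<le> t" for s b
  proof -
    have "(f has_derivative f' (z + s *\<^sub>R v + b *\<^sub>R w)) (at (z + s *\<^sub>R v + b *\<^sub>R w))"
      using that by (intro f' U)
    then have "((\<lambda>s. f (z + s *\<^sub>R v + b *\<^sub>R w)) has_derivative
        (\<lambda>r. f' (z + s *\<^sub>R v + b *\<^sub>R w) (r *\<^sub>R v))) (at s)"
      by (rule has_derivative_compose [rotated]) (auto intro!: derivative_eq_intros)
    moreover have "linear (f' (z + s *\<^sub>R v + b *\<^sub>R w))"
      using that by (intro has_derivative_linear [OF f'] U)
    then have "(\<lambda>r. f' (z + s *\<^sub>R v + b *\<^sub>R w) (r *\<^sub>R v)) = (*) (f' (z + s *\<^sub>R v + b *\<^sub>R w) v)"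
      by (simp add: fun_eq_iff linear_cmul)
    ultimately show ?thesis by (simp add: has_field_derivative_def)
  qed
  have "\<exists>a>0. a < t \<and>
      (f (z + t *\<^sub>R v + t *\<^sub>R w) - f (z + t *\<^sub>R v + 0 *\<^sub>R w))
        - (f (z + 0 *\<^sub>R v + t *\<^sub>R w) - f (z + 0 *\<^sub>R v + 0 *\<^sub>R w))
      = (t - 0) * (f' (z + a *\<^sub>R v + t *\<^sub>R w) v - f' (z + a *\<^sub>R v + 0 *\<^sub>R w) v)"
    using t by (intro MVT2 DERIV_diff along_v) auto
  then obtain a where a: "0 < a" "a < t" and
    eq_a: "f (z + t *\<^sub>R v + t *\<^sub>R w) - f (z + t *\<^sub>R v) - f (z + t *\<^sub>R w) + f z
      = t * (f' (z + a *\<^sub>R v + t *\<^sub>R w) v - f' (z + a *\<^sub>R v) v)"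
    by (auto simp: algebra_simps)
  have along_w: "((\<lambda>s. f' (z + a *\<^sub>R v + s *\<^sub>R w) v) has_field_derivative
      f'' (z + a *\<^sub>R v + s *\<^sub>R w) w) (at s)"
    if "0 \<le> s" "s \<le> t" for s
  proof -
    have "((\<lambda>y. f' y v) has_derivative f'' (z + a *\<^sub>R v + s *\<^sub>R w)) (at (z + a *\<^sub>R v + s *\<^sub>R w))"
      using that a by (intro f'' U) auto
    then have "((\<lambda>s. f' (z + a *\<^sub>R v + s *\<^sub>R w) v) has_derivative
        (\<lambda>r. f'' (z + a *\<^sub>R v + s *\<^sub>R w) (r *\<^sub>R w))) (at s)"
      by (rule has_derivative_compose [rotated]) (auto intro!: derivative_eq_intros)
    moreover have "linear (f'' (z + a *\<^sub>R v + s *\<^sub>R w))"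
      using that a by (intro has_derivative_linear [OF f''] U) auto
    then have "(\<lambda>r. f'' (z + a *\<^sub>R v + s *\<^sub>R w) (r *\<^sub>R w)) = (*) (f'' (z + a *\<^sub>R v + s *\<^sub>R w) w)"
      by (simp add: fun_eq_iff linear_cmul)
    ultimately show ?thesis by (simp add: has_field_derivative_def)
  qed
  have "\<exists>b>0. b < t \<and>
      f' (z + a *\<^sub>R v + t *\<^sub>R w) v - f' (z + a *\<^sub>R v + 0 *\<^sub>R w) v
      = (t - 0) * f'' (z + a *\<^sub>R v + b *\<^sub>R w) w"
    using t by (intro MVT2 along_w) auto
  with a eq_a show ?thesis by auto
qed

text \<open>
Both orders of differentiation compute the same second difference, at two points that tend to
\<open>z\<close> with the size \<open>t\<close> of the parallelogram; continuity of the second derivatives identifies the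
limits.
\<close>
lemma mixed_derivatives_commute:
  fixes f :: "'a::real_normed_vector \<Rightarrow> real"
  assumes U: "open U" "z \<in> U"
    and f': "\<And>x. x \<in> U \<Longrightarrow> (f has_derivative f' x) (at x)"
    and f'': "\<And>x v. x \<in> U \<Longrightarrow> ((\<lambda>y. f' y v) has_derivative f'' v x) (at x)"
    and cont: "\<And>v w. continuous_on U (\<lambda>x. f'' v x w)"
  shows "f'' v z w = f'' w z v"
proof -
  obtain e where e: "e > 0" "ball z e \<subseteq> U"
    using U by (auto simp: open_contains_ball)
  (* Every parallelogram of size t < r stays in the ball of radius e; the summand 1 avoids a
     division by zero when v = w = 0. *)
  define r where "r = e / (norm v + norm w + 1)"
  have r: "r > 0" using e by (simp add: r_def add_nonneg_pos)
  have near: "dist (z + a *\<^sub>R v + b *\<^sub>R w) z \<le> t * (norm v + norm w)"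
    if "0 \<le> a" "a \<le> t" "0 \<le> b" "b \<le> t" for a b t :: real
  proof -
    have "norm (a *\<^sub>R v + b *\<^sub>R w) \<le> a * norm v + b * norm w"
      using norm_triangle_ineq [of "a *\<^sub>R v" "b *\<^sub>R w"] that by simp
    also have "\<dots> \<le> t * norm v + t * norm w"
      using that by (intro add_mono mult_right_mono) auto
    finally show ?thesis by (simp add: dist_norm algebra_simps)
  qed
  have inU: "z + a *\<^sub>R v + b *\<^sub>R w \<in> U"
    if "0 \<le> a" "a \<le> t" "0 \<le> b" "b \<le> t" "t < r" for a b t
  proof -
    have "t * (norm v + norm w) \<le> t * (norm v + norm w + 1)"
      using that by (intro mult_left_mono) auto
    also have "\<dots> < e"
      using that by (simp add: r_def pos_less_divide_eq add_nonneg_pos)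
    finally show ?thesis using near [of a t b] that e(2) by (auto simp: dist_commute)
  qed
  have "\<exists>x y. dist x z \<le> t * (norm v + norm w) \<and> dist y z \<le> t * (norm v + norm w) \<and>
      f'' v x w = f'' w y v" if t: "0 < t" "t < r" for t
  proof -
    obtain a b where ab: "0 < a" "a < t" "0 < b" "b < t" and
      1: "f (z + t *\<^sub>R v + t *\<^sub>R w) - f (z + t *\<^sub>R v) - f (z + t *\<^sub>R w) + f z
        = t * (t * f'' v (z + a *\<^sub>R v + b *\<^sub>R w) w)"
      using second_difference_mean_value [of t z v w U f f' "f'' v", OF t(1) _ f' f''] inU t(2)
      by blast
    have inU': "z + a *\<^sub>R w + b *\<^sub>R v \<in> U" if "0 \<le> a" "a \<le> t" "0 \<le> b" "b \<le> t" for a b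
      using inU [of b t a] that t(2) by (simp add: add_ac)
    obtain c d where cd: "0 < c" "c < t" "0 < d" "d < t" and
      2: "f (z + t *\<^sub>R w + t *\<^sub>R v) - f (z + t *\<^sub>R w) - f (z + t *\<^sub>R v) + f z
        = t * (t * f'' w (z + c *\<^sub>R w + d *\<^sub>R v) v)"
      using second_difference_mean_value [of t z w v U f f' "f'' w", OF t(1) _ f' f''] inU'
      by blast
    have "t * (t * f'' v (z + a *\<^sub>R v + b *\<^sub>R w) w) = t * (t * f'' w (z + c *\<^sub>R w + d *\<^sub>R v) v)"
    proof -
      have "z + t *\<^sub>R w + t *\<^sub>R v = z + t *\<^sub>R v + t *\<^sub>R w" by (simp add: add_ac)
      with 1 2 show ?thesis by (smt (verit))
    qed
    then have "f'' v (z + a *\<^sub>R v + b *\<^sub>R w) w = f'' w (z + d *\<^sub>R v + c *\<^sub>R w) v"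
      using t by (simp add: add_ac)
    then show ?thesis using near [of a t b] near [of d t c] ab cd by (meson less_imp_le)
  qed
  then obtain X Y where XY: "\<And>t. \<lbrakk>0 < t; t < r\<rbrakk> \<Longrightarrow>
      dist (X t) z \<le> t * (norm v + norm w) \<and> dist (Y t) z \<le> t * (norm v + norm w) \<and>
      f'' v (X t) w = f'' w (Y t) v"
    by metis
  have ev: "\<forall>\<^sub>F t in at_right 0. 0 < t \<and> t < r"
    using r by (auto simp: eventually_at_right_field)
  have lim0: "((\<lambda>t. t * (norm v + norm w)) \<longlongrightarrow> 0) (at_right 0)"
    by (auto intro!: tendsto_eq_intros)
  have squeeze: "(Z \<longlongrightarrow> z) (at_right 0)"
    if "\<And>t. \<lbrakk>0 < t; t < r\<rbrakk> \<Longrightarrow> dist (Z t) z \<le> t * (norm v + norm w)" for Z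
  proof (subst tendsto_dist_iff, rule tendsto_sandwich [OF _ _ tendsto_const lim0])
    show "\<forall>\<^sub>F t in at_right 0. dist (Z t) z \<le> t * (norm v + norm w)"
      using ev by eventually_elim (use that in blast)
  qed simp
  have X: "(X \<longlongrightarrow> z) (at_right 0)" and Y: "(Y \<longlongrightarrow> z) (at_right 0)"
    using XY by (auto intro: squeeze)
  have isc: "isCont (\<lambda>x. f'' v x w) z" "isCont (\<lambda>x. f'' w x v) z"
    using cont U by (auto simp: continuous_on_eq_continuous_at)
  have "((\<lambda>t. f'' v (X t) w) \<longlongrightarrow> f'' v z w) (at_right 0)"
    using isCont_tendsto_compose [OF isc(1) X] .
  moreover have "((\<lambda>t. f'' v (X t) w) \<longlongrightarrow> f'' w z v) (at_right 0)"
    using isCont_tendsto_compose [OF isc(2) Y]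
  proof (rule Lim_transform_eventually)
    show "\<forall>\<^sub>F t in at_right 0. f'' w (Y t) v = f'' v (X t) w"
      using ev by eventually_elim (use XY in force)
  qed
  ultimately show ?thesis
    by (intro tendsto_unique) auto
qed

section \<open>The gradient field of a smooth Hamiltonian\<close>

text \<open>
The function and its partial derivatives are bounded on the compact set \<open>D\<close>, and convexity keeps
segments in \<open>D\<close>, so that the mean value inequality applies.
\<close>
lemma C1_bounded_Lipschitz:
  fixes f :: "'a::euclidean_space \<Rightarrow> real"
  assumes D: "compact D" "convex D" "D \<subseteq> U" and f: "Ck_on 1 f U"
  shows "\<exists>L\<ge>0. (\<forall>x\<in>D. \<bar>f x\<bar> \<le> L) \<and> (\<forall>x\<in>D. \<forall>y\<in>D. \<bar>f x - f y\<bar> \<le> L * norm (x - y))"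
proof -
  let ?f' = "\<lambda>x. frechet_derivative f (at x)"
  have der: "(f has_derivative ?f' x) (at x)" if "x \<in> D" for x
    using f D that frechet_derivative_works by fastforce
  have "compact (f ` D)"
    using der D by (intro compact_continuous_image continuous_at_imp_continuous_on)
      (auto intro: has_derivative_continuous)
  then obtain B0 where B0: "\<And>x. x \<in> D \<Longrightarrow> \<bar>f x\<bar> \<le> B0"
    using compact_imp_bounded [of "f ` D"] by (fastforce simp: bounded_iff)
  have "\<exists>B. \<forall>x\<in>D. \<bar>?f' x b\<bar> \<le> B" for b
  proof -
    have "continuous_on D (\<lambda>x. ?f' x b)"
      using f D by (auto intro: continuous_on_subset)
    then have "bounded ((\<lambda>x. ?f' x b) ` D)"
      using D by (intro compact_imp_bounded compact_continuous_image)
    then show ?thesis by (auto simp: bounded_iff)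
  qed
  then obtain B where B: "\<And>b x. x \<in> D \<Longrightarrow> \<bar>?f' x b\<bar> \<le> B b" by metis
  define L where "L = max (max 0 B0) (\<Sum>b\<in>Basis. B b)"
  have "onorm (?f' x) \<le> L" if x: "x \<in> D" for x
  proof (rule onorm_le)
    fix u :: 'a
    have "linear (?f' x)" using der [OF x] by (rule has_derivative_linear)
    then have "?f' x u = (\<Sum>b\<in>Basis. (u \<bullet> b) * ?f' x b)"
      by (subst euclidean_representation [of u, symmetric])
        (simp add: linear_sum linear_scale)
    then have "norm (?f' x u) \<le> (\<Sum>b\<in>Basis. \<bar>u \<bullet> b\<bar> * \<bar>?f' x b\<bar>)"
      using sum_abs [of "\<lambda>b. (u \<bullet> b) * ?f' x b" Basis] by (simp add: abs_mult)
    also have "\<dots> \<le> (\<Sum>b\<in>Basis. norm u * B b)"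
      using B [OF x] by (intro sum_mono mult_mono) (auto simp: Basis_le_norm)
    also have "\<dots> = (\<Sum>b\<in>Basis. B b) * norm u"
      by (simp add: sum_distrib_left mult.commute)
    also have "\<dots> \<le> L * norm u"
      by (intro mult_right_mono) (simp_all add: L_def)
    finally show "norm (?f' x u) \<le> L * norm u" .
  qed
  then have "\<bar>f x - f y\<bar> \<le> L * norm (x - y)" if "x \<in> D" "y \<in> D" for x y
    using differentiable_bound [OF D(2), of f ?f' L x y] der that
    by (auto intro: has_derivative_at_withinI)
  moreover have "\<bar>f x\<bar> \<le> L" if "x \<in> D" for x using B0 [OF that] by (simp add: L_def)
  moreover have "L \<ge> 0" by (simp add: L_def)
  ultimately show ?thesis by blast
qed

lemma linear_functional_expand:
  fixes f :: "'a::euclidean_space \<Rightarrow> 'b::real_vector"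
  assumes "linear f"
  shows "f u = (\<Sum>b\<in>Basis. (u \<bullet> b) *\<^sub>R f b)"
  using assms by (subst euclidean_representation [of u, symmetric]) (simp add: linear_sum linear_scale)

text \<open>
This extracts from smoothness what the analysis of one step uses: a gradient field \<open>G\<close> and its
derivative \<open>K\<close>, the Hessian of \<open>H\<close>, which is symmetric by the commutation of mixed derivatives.
The bounds hold because the first three derivatives are continuous, hence bounded, on the compact
set \<open>D\<close>; convexity of \<open>D\<close> turns the bound on the third derivatives into a Lipschitz constant for
the Hessian. A single constant \<open>L\<close> serves all three estimates.
\<close>
lemma smooth_near_imp_regular_gradient:
  fixes H :: "'a::euclidean_space \<Rightarrow> real"
  assumes D: "compact D" "convex D" and H: "smooth_near H D"
  obtains U G K L where "open U" "D \<subseteq> U" "L \<ge> 0"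
    "\<And>x. x \<in> U \<Longrightarrow> GDERIV H x :> G x"
    "\<And>x. x \<in> U \<Longrightarrow> (G has_derivative K x) (at x)"
    "\<And>x u v. x \<in> U \<Longrightarrow> K x u \<bullet> v = u \<bullet> K x v"
    "\<And>x. x \<in> D \<Longrightarrow> norm (G x) \<le> L"
    "\<And>x u. x \<in> D \<Longrightarrow> norm (K x u) \<le> L * norm u"
    "\<And>x y u. \<lbrakk>x \<in> D; y \<in> D\<rbrakk> \<Longrightarrow> norm (K x u - K y u) \<le> L * norm (x - y) * norm u"
proof -
  obtain U where U: "open U" "D \<subseteq> U" and smooth: "\<And>k. Ck_on k H U"
    using H by (auto simp: smooth_near_def)
  define D1 where "D1 v x = frechet_derivative H (at x) v" for v x
  define D2 where "D2 v x = frechet_derivative (D1 v) (at x)" for v x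
  define G where "G x = (\<Sum>b\<in>Basis. D1 b x *\<^sub>R b)" for x
  define K where "K x u = (\<Sum>b\<in>Basis. D2 b x u *\<^sub>R b)" for x u
  have C1: "Ck_on k (D1 v) U" for k v
    using smooth [of "Suc k"] by (simp add: D1_def [abs_def])
  have C2: "Ck_on k (\<lambda>x. D2 v x w) U" for k v w
    using C1 [of "Suc k"] by (simp add: D2_def [abs_def])
  have H': "(H has_derivative (\<lambda>v. D1 v x)) (at x)" if "x \<in> U" for x
    using smooth [of 1] that frechet_derivative_works [of H "at x"] by (simp add: D1_def)
  have D1': "(D1 v has_derivative D2 v x) (at x)" if "x \<in> U" for v x
    using C1 [of 1] that frechet_derivative_works [of "D1 v" "at x"] by (simp add: D2_def)
  have grad: "GDERIV H x :> G x" if "x \<in> U" for x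
  proof -
    have "D1 v x = v \<bullet> G x" for v
      using linear_functional_expand [OF has_derivative_linear [OF H' [OF that]], of v]
      by (simp add: G_def inner_sum_right mult.commute)
    then show ?thesis using H' [OF that] by (simp add: gderiv_def)
  qed
  have hess: "(G has_derivative K x) (at x)" if "x \<in> U" for x
    unfolding G_def [abs_def] K_def [abs_def]
    by (auto intro!: derivative_eq_intros D1' that)
  have sym: "K x u \<bullet> v = u \<bullet> K x v" if "x \<in> U" for x u v
  proof -
    have *: "D2 v x w = D2 w x v" for v w
      using U(1) that H' D1' C2 [of 0]
      by (intro mixed_derivatives_commute [of U x H "\<lambda>x v. D1 v x"]) auto
    have expand: "D2 v x w = (\<Sum>b\<in>Basis. (w \<bullet> b) * D2 v x b)" for v w
      using linear_functional_expand [OF has_derivative_linear [OF D1' [OF that]], of v w] by simp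
    have "K x u \<bullet> v = D2 u x v" for u v
    proof -
      have "K x u \<bullet> v = (\<Sum>b\<in>Basis. (v \<bullet> b) * D2 b x u)"
        by (simp add: K_def inner_sum_left inner_commute [of v] mult.commute)
      also have "\<dots> = (\<Sum>b\<in>Basis. (v \<bullet> b) * D2 u x b)"
        by (simp only: * [of _ u])
      finally show ?thesis by (simp add: expand [of u v])
    qed
    then show ?thesis using * by (simp add: inner_commute [of u])
  qed
  have "\<exists>L\<ge>0. (\<forall>x\<in>D. \<bar>D1 b x\<bar> \<le> L) \<and> (\<forall>x\<in>D. \<forall>y\<in>D. \<bar>D1 b x - D1 b y\<bar> \<le> L * norm (x - y))" for b
    by (rule C1_bounded_Lipschitz [OF D U(2) C1])
  then obtain L1 where L1: "\<And>b. 0 \<le> L1 b" "\<And>b x. x \<in> D \<Longrightarrow> \<bar>D1 b x\<bar> \<le> L1 b" by metis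
  have "\<exists>L\<ge>0. (\<forall>x\<in>D. \<bar>D2 b x c\<bar> \<le> L) \<and>
      (\<forall>x\<in>D. \<forall>y\<in>D. \<bar>D2 b x c - D2 b y c\<bar> \<le> L * norm (x - y))" for b c
    by (rule C1_bounded_Lipschitz [OF D U(2) C2])
  then obtain L2 where L2: "\<And>b c. 0 \<le> L2 b c" "\<And>b c x. x \<in> D \<Longrightarrow> \<bar>D2 b x c\<bar> \<le> L2 b c"
    "\<And>b c x y. \<lbrakk>x \<in> D; y \<in> D\<rbrakk> \<Longrightarrow> \<bar>D2 b x c - D2 b y c\<bar> \<le> L2 b c * norm (x - y)"
    by metis
  define S1 where "S1 = (\<Sum>b\<in>Basis. L1 b)"
  define S2 where "S2 = (\<Sum>b\<in>Basis. \<Sum>c\<in>Basis. L2 b c)"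
  have S: "S1 \<ge> 0" "S2 \<ge> 0" using L1(1) L2(1) by (auto simp: S1_def S2_def intro!: sum_nonneg)
  have G_bound: "norm (G x) \<le> S1" if "x \<in> D" for x
    unfolding G_def S1_def by (rule sum_norm_le) (use L1 that in auto)
  (* A family of linear functionals that is bounded on the basis is bounded in operator norm by
     the sum of these bounds; applied to the Hessian and to differences of Hessians. *)
  have coordinate_bound: "norm (\<Sum>b\<in>Basis. A b u *\<^sub>R b) \<le> (\<Sum>b\<in>Basis. \<Sum>c\<in>Basis. a b c) * norm u"
    if lin: "\<And>b. linear (A b)" and a: "\<And>b c. \<bar>A b c\<bar> \<le> a b c"
    for A :: "'a \<Rightarrow> 'a \<Rightarrow> real" and a and u :: 'a
  proof -
    have "\<bar>A b u\<bar> \<le> (\<Sum>c\<in>Basis. a b c) * norm u" for b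
    proof -
      have "\<bar>A b u\<bar> \<le> (\<Sum>c\<in>Basis. \<bar>u \<bullet> c\<bar> * \<bar>A b c\<bar>)"
        using sum_abs [of "\<lambda>c. (u \<bullet> c) * A b c" Basis]
        by (subst linear_functional_expand [OF lin]) (simp add: abs_mult)
      also have "\<dots> \<le> (\<Sum>c\<in>Basis. norm u * a b c)"
        by (intro sum_mono mult_mono a) (auto simp: Basis_le_norm)
      finally show ?thesis by (simp add: sum_distrib_left mult.commute)
    qed
    then show ?thesis
      unfolding sum_distrib_right [of _ Basis "norm u"] by (intro sum_norm_le) simp
  qed
  have K_bound: "norm (K x u) \<le> S2 * norm u" if "x \<in> D" for x u
    unfolding K_def S2_def
  proof (rule coordinate_bound)
    show "linear (D2 b x)" for b
      using that U(2) by (intro has_derivative_linear [OF D1']) auto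
    show "\<bar>D2 b x c\<bar> \<le> L2 b c" for b c
      using that by (rule L2(2))
  qed
  have K_Lipschitz: "norm (K x u - K y u) \<le> S2 * norm (x - y) * norm u"
    if "x \<in> D" "y \<in> D" for x y u
  proof -
    have "norm (\<Sum>b\<in>Basis. (D2 b x u - D2 b y u) *\<^sub>R b)
        \<le> (\<Sum>b\<in>Basis. \<Sum>c\<in>Basis. L2 b c * norm (x - y)) * norm u"
    proof (rule coordinate_bound [of "\<lambda>b u. D2 b x u - D2 b y u"])
      show "linear (\<lambda>u. D2 b x u - D2 b y u)" for b
        using that U(2) by (intro linear_compose_sub has_derivative_linear [OF D1']) auto
      show "\<bar>D2 b x c - D2 b y c\<bar> \<le> L2 b c * norm (x - y)" for b c
        using that by (rule L2(3))
    qed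
    then show ?thesis
      by (simp add: K_def S2_def sum_distrib_right scaleR_diff_left sum_subtractf)
  qed
  have "norm (G x) \<le> S1 + S2" if "x \<in> D" for x
    using G_bound [OF that] S by linarith
  moreover have "norm (K x u) \<le> (S1 + S2) * norm u" if "x \<in> D" for x u
    using K_bound [OF that, of u] S by (simp add: distrib_right add_increasing)
  moreover have "norm (K x u - K y u) \<le> (S1 + S2) * norm (x - y) * norm u"
    if "x \<in> D" "y \<in> D" for x y u
    using K_Lipschitz [OF that, of u] S by (simp add: distrib_right add_increasing)
  moreover have "S1 + S2 \<ge> 0" using S by simp
  ultimately show thesis
    by (intro that [of U "S1 + S2" G K] U grad hess sym)
qed

section \<open>The canonical form and its defect under a map\<close>

lemma norm_fst_le_norm: "norm (fst u) \<le> norm u"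
  by (metis norm_fst_le prod.collapse)

lemma norm_snd_le_norm: "norm (snd u) \<le> norm u"
  by (metis norm_snd_le prod.collapse)

definition canonical_form :: "'a::real_inner \<times> 'a \<Rightarrow> 'a \<times> 'a \<Rightarrow> real" where
  "canonical_form u v = fst u \<bullet> snd v - snd u \<bullet> fst v"

lemma canonical_form_swap: "canonical_form (prod.swap u) (prod.swap v) = - canonical_form u v"
  by (simp add: canonical_form_def inner_commute)

text \<open>
In block form \<open>symplectic_defect T z\<close> is the bilinear form of the matrix \<open>(DT)\<^sup>T J (DT) - J\<close>. It
vanishes for all \<open>z\<close> exactly when the differentiable map \<open>T\<close> is symplectic. Arguing with the form rather than with the
matrix keeps the estimates free of coordinates.
\<close>
definition symplectic_defect ::
    "('a::real_inner \<times> 'a \<Rightarrow> 'a \<times> 'a) \<Rightarrow> 'a \<times> 'a \<Rightarrow> 'a \<times> 'a \<Rightarrow> 'a \<times> 'a \<Rightarrow> real" where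
  "symplectic_defect T z u v =
     canonical_form (frechet_derivative T (at z) u) (frechet_derivative T (at z) v) - canonical_form u v"

lemma symplectic_defect_eq:
  assumes "(T has_derivative T') (at z)"
  shows "symplectic_defect T z u v = canonical_form (T' u) (T' v) - canonical_form u v"
  using assms by (simp add: symplectic_defect_def frechet_derivative_at [symmetric])

text \<open>
The chain rule \<open>D(S \<circ> T) = DS DT\<close> makes defects additive, up to the distortion of the arguments
by \<open>DT\<close>. This is why the order of a composition is governed by the orders of its factors.
\<close>
lemma symplectic_defect_compose:
  assumes "T differentiable (at z)" "S differentiable (at (T z))"
  shows "symplectic_defect (S \<circ> T) z u v = symplectic_defect T z u v +
    symplectic_defect S (T z) (frechet_derivative T (at z) u) (frechet_derivative T (at z) v)"
  using assms by (simp add: symplectic_defect_def frechet_derivative_compose)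

text \<open>
Exchanging the roles of \<open>q\<close> and \<open>p\<close> maps the canonical form to its negative. Conjugation with
this exchange carries \<open>p\<close>-implicit schemes to \<open>q\<close>-implicit ones, so that only the former need
to be analysed.
\<close>
definition swap_conj :: "('a \<times> 'a \<Rightarrow> 'a \<times> 'a) \<Rightarrow> 'a \<times> 'a \<Rightarrow> 'a \<times> 'a" where
  "swap_conj T z = prod.swap (T (prod.swap z))"

lemma swap_conj_swap_conj [simp]: "swap_conj (swap_conj T) = T"
  by (simp add: swap_conj_def fun_eq_iff)

lemma swap_conj_compose: "swap_conj (S \<circ> T) = swap_conj S \<circ> swap_conj T"
  by (simp add: swap_conj_def fun_eq_iff)

lemma bounded_linear_swap:
  "bounded_linear (prod.swap :: 'a::real_normed_vector \<times> 'b::real_normed_vector \<Rightarrow> 'b \<times> 'a)"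
  unfolding prod.swap_def [abs_def] by (intro bounded_linear_Pair bounded_linear_fst bounded_linear_snd)

lemma norm_swap [simp]: "norm (prod.swap z) = norm z"
  by (simp add: norm_prod_def add.commute)

lemma swap_conj_has_derivative:
  assumes "(T has_derivative T') (at (prod.swap z))"
  shows "(swap_conj T has_derivative swap_conj T') (at z)"
proof -
  have "((\<lambda>z. T (prod.swap z)) has_derivative (\<lambda>u. T' (prod.swap u))) (at z)"
    by (rule has_derivative_compose [OF bounded_linear_imp_has_derivative [OF bounded_linear_swap] assms])
  then show ?thesis
    unfolding swap_conj_def [abs_def] by (rule bounded_linear.has_derivative [OF bounded_linear_swap])
qed

lemma swap_conj_differentiable:
  assumes "T differentiable (at (prod.swap z))"
  shows "swap_conj T differentiable (at z)"
  using assms swap_conj_has_derivative unfolding differentiable_def by blast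

lemma symplectic_defect_swap_conj:
  assumes "T differentiable (at (prod.swap z))"
  shows "symplectic_defect (swap_conj T) z u v
    = - symplectic_defect T (prod.swap z) (prod.swap u) (prod.swap v)"
proof -
  have "(T has_derivative frechet_derivative T (at (prod.swap z))) (at (prod.swap z))"
    using assms frechet_derivative_works by blast
  from symplectic_defect_eq [OF swap_conj_has_derivative [OF this]] show ?thesis
    using canonical_form_swap [of u v]
    by (simp add: symplectic_defect_def swap_conj_def canonical_form_swap)
qed

section \<open>The implicit Euler step with fixed point iterations\<close>

text \<open>
The scheme depends on the Hamiltonian only through its gradient, so it is formulated for an
arbitrary vector field \<open>G\<close>, the components \<open>fst \<circ> G\<close> and \<open>snd \<circ> G\<close> standing for \<open>H\<^sub>q\<close> and \<open>H\<^sub>p\<close>. In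
this generality the \<open>q\<close>-implicit scheme is the same scheme for another field.
\<close>
primrec momentum_iter :: "('a::real_vector \<times> 'a \<Rightarrow> 'a \<times> 'a) \<Rightarrow> real \<Rightarrow> 'a \<times> 'a \<Rightarrow> nat \<Rightarrow> 'a" where
  "momentum_iter G h z 0 = snd z"
| "momentum_iter G h z (Suc n) = snd z - h *\<^sub>R fst (G (fst z, momentum_iter G h z n))"

definition euler_step :: "('a::real_vector \<times> 'a \<Rightarrow> 'a \<times> 'a) \<Rightarrow> nat \<Rightarrow> real \<Rightarrow> 'a \<times> 'a \<Rightarrow> 'a \<times> 'a" where
  "euler_step G M h z =
     (fst z + h *\<^sub>R snd (G (fst z, momentum_iter G h z M)), momentum_iter G h z M)"

definition euler_points_in ::
    "('a::real_vector \<times> 'a) set \<Rightarrow> ('a \<times> 'a \<Rightarrow> 'a \<times> 'a) \<Rightarrow> nat \<Rightarrow> real \<Rightarrow> 'a \<times> 'a \<Rightarrow> bool" where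
  "euler_points_in D G M h z \<longleftrightarrow> (\<forall>n\<le>M. (fst z, momentum_iter G h z n) \<in> D)"

text \<open>
Symmetry of \<open>K z\<close> expresses that \<open>G\<close> is a gradient; this is the only way in which the
Hamiltonian character of the system enters.
\<close>
locale gradient_field =
  fixes G :: "'a::real_inner \<times> 'a \<Rightarrow> 'a \<times> 'a"
    and K :: "'a \<times> 'a \<Rightarrow> 'a \<times> 'a \<Rightarrow> 'a \<times> 'a"
    and D :: "('a \<times> 'a) set" and L :: real
  assumes convex: "convex D"
    and deriv: "z \<in> D \<Longrightarrow> (G has_derivative K z) (at z)"
    and symmetric: "z \<in> D \<Longrightarrow> K z u \<bullet> v = u \<bullet> K z v"
    and L_nonneg: "0 \<le> L"
    and bound: "z \<in> D \<Longrightarrow> norm (G z) \<le> L"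
    and deriv_bound: "z \<in> D \<Longrightarrow> norm (K z u) \<le> L * norm u"
    and deriv_Lipschitz:
      "\<lbrakk>z \<in> D; w \<in> D\<rbrakk> \<Longrightarrow> norm (K z u - K w u) \<le> L * norm (z - w) * norm u"
begin

lemma Lipschitz:
  assumes "z \<in> D" "w \<in> D"
  shows "norm (G z - G w) \<le> L * norm (z - w)"
proof (rule differentiable_bound [OF convex])
  show "(G has_derivative K x) (at x within D)" if "x \<in> D" for x
    using deriv [OF that] by (rule has_derivative_at_withinI)
  show "onorm (K x) \<le> L" if "x \<in> D" for x
    using L_nonneg deriv_bound [OF that] by (intro onorm_bound) (auto simp: mult.commute)
qed (use assms in auto)

primrec iter_deriv :: "real \<Rightarrow> 'a \<times> 'a \<Rightarrow> nat \<Rightarrow> 'a \<times> 'a \<Rightarrow> 'a" where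
  "iter_deriv h z 0 u = snd u"
| "iter_deriv h z (Suc n) u =
     snd u - h *\<^sub>R fst (K (fst z, momentum_iter G h z n) (fst u, iter_deriv h z n u))"

lemma momentum_iter_has_derivative:
  assumes "\<And>k. k < n \<Longrightarrow> (fst z, momentum_iter G h z k) \<in> D"
  shows "((\<lambda>z. momentum_iter G h z n) has_derivative iter_deriv h z n) (at z)"
  using assms
proof (induction n)
  case 0
  then show ?case by (auto intro!: derivative_eq_intros simp: fun_eq_iff)
next
  case (Suc n)
  then have IH: "((\<lambda>z. momentum_iter G h z n) has_derivative iter_deriv h z n) (at z)"
    and D: "(fst z, momentum_iter G h z n) \<in> D"
    by auto
  have "((\<lambda>z. (fst z, momentum_iter G h z n)) has_derivative (\<lambda>u. (fst u, iter_deriv h z n u))) (at z)"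
    by (auto intro!: derivative_eq_intros IH)
  from has_derivative_compose [OF this deriv [OF D]]
  show ?case by (auto intro!: derivative_eq_intros simp: fun_eq_iff)
qed

definition step_deriv :: "nat \<Rightarrow> real \<Rightarrow> 'a \<times> 'a \<Rightarrow> 'a \<times> 'a \<Rightarrow> 'a \<times> 'a" where
  "step_deriv M h z u =
     (fst u + h *\<^sub>R snd (K (fst z, momentum_iter G h z M) (fst u, iter_deriv h z M u)), iter_deriv h z M u)"

lemma euler_step_has_derivative:
  assumes "euler_points_in D G M h z"
  shows "(euler_step G M h has_derivative step_deriv M h z) (at z)"
proof -
  have iter: "((\<lambda>z. momentum_iter G h z M) has_derivative iter_deriv h z M) (at z)"
    using assms by (intro momentum_iter_has_derivative) (auto simp: euler_points_in_def)
  have D: "(fst z, momentum_iter G h z M) \<in> D"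
    using assms by (auto simp: euler_points_in_def)
  have "((\<lambda>z. (fst z, momentum_iter G h z M)) has_derivative (\<lambda>u. (fst u, iter_deriv h z M u))) (at z)"
    by (auto intro!: derivative_eq_intros iter)
  from has_derivative_compose [OF this deriv [OF D]] show ?thesis
    unfolding euler_step_def [abs_def] step_deriv_def [abs_def]
    by (auto intro!: derivative_eq_intros iter)
qed

lemma euler_step_differentiable:
  "euler_points_in D G M h z \<Longrightarrow> euler_step G M h differentiable (at z)"
  unfolding differentiable_def by (blast intro: euler_step_has_derivative)

text \<open>
The derivative of the residual \<open>p_M - (p - h H\<^sub>q(q, p_M))\<close> of the implicit equation after \<open>M\<close>
iterations, up to sign. The iterate \<open>M + 1\<close> occurs only as a name for \<open>p - h H\<^sub>q(q, p_M)\<close>: its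
formula evaluates \<open>G\<close> no further than at iterate \<open>M\<close>.
\<close>
definition iter_deriv_gap :: "nat \<Rightarrow> real \<Rightarrow> 'a \<times> 'a \<Rightarrow> 'a \<times> 'a \<Rightarrow> 'a" where
  "iter_deriv_gap M h z u = iter_deriv h z (Suc M) u - iter_deriv h z M u"

text \<open>
An exact solution of the implicit equation would give a symplectic map. With \<open>r = p_(M+1) - p_M\<close>
the computed values solve the equation with \<open>p\<close> replaced by \<open>p - r\<close>, and symmetry of the Hessian
cancels all terms in \<open>h\<close>, leaving \<open>dq' \<and> dp' = dq \<and> dp - dq \<and> dr\<close>. The remainder contains the
factor \<open>dq\<close>, hence the defect vanishes on pairs of vectors in the direction of \<open>p\<close>; this is the
source of the better order of one of the blocks.
\<close>
lemma euler_step_defect: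
  assumes "euler_points_in D G M h z"
  shows "symplectic_defect (euler_step G M h) z u v =
    fst v \<bullet> iter_deriv_gap M h z u - fst u \<bullet> iter_deriv_gap M h z v"
proof -
  let ?K = "K (fst z, momentum_iter G h z M)"
  let ?u = "(fst u, iter_deriv h z M u)" and ?v = "(fst v, iter_deriv h z M v)"
  have "?K ?u \<bullet> ?v = ?u \<bullet> ?K ?v"
    using assms by (intro symmetric) (auto simp: euler_points_in_def)
  then have "fst (?K ?u) \<bullet> fst v + snd (?K ?u) \<bullet> iter_deriv h z M v
      = fst u \<bullet> fst (?K ?v) + iter_deriv h z M u \<bullet> snd (?K ?v)"
    by (simp add: inner_prod_def)
  (* By this identity the terms with factor h cancel in the expansion of the form. *)
  then have "h * (fst (?K ?u) \<bullet> fst v) + h * (snd (?K ?u) \<bullet> iter_deriv h z M v)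
      = h * (fst u \<bullet> fst (?K ?v)) + h * (iter_deriv h z M u \<bullet> snd (?K ?v))"
    by (metis distrib_left)
  then show ?thesis
    by (simp add: symplectic_defect_eq [OF euler_step_has_derivative [OF assms]] canonical_form_def
        step_deriv_def iter_deriv_gap_def inner_add_left inner_add_right inner_diff_left inner_diff_right
        inner_commute)
qed

lemma iter_deriv_bound:
  "\<exists>C\<ge>0. \<forall>h z u. 0 \<le> h \<longrightarrow> h \<le> 1 \<longrightarrow> (\<forall>k<n. (fst z, momentum_iter G h z k) \<in> D) \<longrightarrow>
     norm (iter_deriv h z n u) \<le> C * norm u"
proof (induction n)
  case 0
  show ?case by (intro exI [of _ 1]) (simp add: norm_snd_le_norm)
next
  case (Suc n)
  then obtain C where C: "C \<ge> 0" "\<And>h z u. \<lbrakk>0 \<le> h; h \<le> 1; \<forall>k<n. (fst z, momentum_iter G h z k) \<in> D\<rbrakk>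
      \<Longrightarrow> norm (iter_deriv h z n u) \<le> C * norm u"
    by blast
  have "norm (iter_deriv h z (Suc n) u) \<le> (1 + L * (1 + C)) * norm u"
    if h: "0 \<le> h" "h \<le> 1" and D: "\<forall>k<Suc n. (fst z, momentum_iter G h z k) \<in> D" for h z u
  proof -
    let ?K = "K (fst z, momentum_iter G h z n) (fst u, iter_deriv h z n u)"
    have "norm (fst u, iter_deriv h z n u) \<le> norm (fst u) + norm (iter_deriv h z n u)"
      by (rule norm_Pair_le)
    also have "\<dots> \<le> norm u + C * norm u"
      using C(2) [of h z u] h D by (intro add_mono) (auto simp: norm_fst_le_norm)
    finally have "L * norm (fst u, iter_deriv h z n u) \<le> L * ((1 + C) * norm u)"
      using L_nonneg by (intro mult_left_mono) (auto simp: algebra_simps)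
    then have K: "norm ?K \<le> L * ((1 + C) * norm u)"
      using deriv_bound D by (meson lessI order_trans)
    have "norm (snd u - h *\<^sub>R fst ?K) \<le> norm (snd u) + \<bar>h\<bar> * norm (fst ?K)"
      using norm_triangle_ineq4 [of "snd u" "h *\<^sub>R fst ?K"] by simp
    also have "\<dots> \<le> norm u + 1 * norm ?K"
      using h by (intro add_mono mult_mono norm_fst_le_norm norm_snd_le_norm) auto
    finally show ?thesis using K by (simp add: algebra_simps)
  qed
  moreover have "1 + L * (1 + C) \<ge> 0" using C(1) L_nonneg by simp
  ultimately show ?case by blast
qed

text \<open>
The fixed point map has Lipschitz constant \<open>L h\<close>, and the first correction is at most \<open>L h\<close>.
\<close>
lemma iter_gap_bound:
  assumes "0 \<le> h" and "\<forall>k\<le>n. (fst z, momentum_iter G h z k) \<in> D"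
  shows "norm (momentum_iter G h z (Suc n) - momentum_iter G h z n) \<le> (L * h) ^ Suc n"
  using assms(2)
proof (induction n)
  case 0
  have "h * norm (fst (G (fst z, snd z))) \<le> h * L"
    using 0 assms(1) bound [of "(fst z, snd z)"] norm_fst_le_norm [of "G (fst z, snd z)"]
    by (intro mult_left_mono) auto
  with assms(1) show ?case by (simp add: mult.commute)
next
  case (Suc n)
  let ?z = "\<lambda>k. (fst z, momentum_iter G h z k)"
  have "norm (momentum_iter G h z (Suc (Suc n)) - momentum_iter G h z (Suc n))
      = h * norm (fst (G (?z (Suc n)) - G (?z n)))"
    using assms(1) by (simp flip: scaleR_diff_right) (simp add: norm_minus_commute)
  also have "\<dots> \<le> h * (L * norm (?z (Suc n) - ?z n))"
  proof (intro mult_left_mono assms(1))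
    show "norm (fst (G (?z (Suc n)) - G (?z n))) \<le> L * norm (?z (Suc n) - ?z n)"
      using Suc.prems by (intro order_trans [OF norm_fst_le_norm] Lipschitz) auto
  qed
  also have "\<dots> \<le> h * (L * (L * h) ^ Suc n)"
    using Suc assms(1) L_nonneg
    by (intro mult_left_mono) (auto simp: norm_Pair simp del: momentum_iter.simps power_Suc)
  finally show ?case by (simp add: mult_ac)
qed

text \<open>
Differentiated, the fixed point iteration still gains one factor \<open>h\<close> per step. With
\<open>z_k = (q, p_k)\<close> and \<open>u_k\<close> the derivative of \<open>z_k\<close> in direction \<open>u\<close>, the new gap is \<open>h\<close> times
\<open>K z_(n+1) u_(n+1) - K z_n u_n = K z_(n+1) (u_(n+1) - u_n) + (K z_(n+1) - K z_n) u_n\<close>. The first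
term is of order \<open>h^(n+1)\<close> by induction, and so is the second, because \<open>K\<close> is Lipschitz and
\<open>z_(n+1) - z_n\<close> is of that order by the preceding lemma.
\<close>
lemma iter_deriv_gap_bound:
  "\<exists>C\<ge>0. \<forall>h z u. 0 \<le> h \<longrightarrow> h \<le> 1 \<longrightarrow> euler_points_in D G n h z \<longrightarrow>
     norm (iter_deriv_gap n h z u) \<le> C * h ^ Suc n * norm u"
proof (induction n)
  case 0
  have "norm (iter_deriv_gap 0 h z u) \<le> L * h ^ Suc 0 * norm u"
    if h: "0 \<le> h" and D: "euler_points_in D G 0 h z" for h z u
  proof -
    have "norm (fst (K (fst z, snd z) (fst u, snd u))) \<le> norm (K (fst z, snd z) (fst u, snd u))"
      by (rule norm_fst_le_norm)
    also have "\<dots> \<le> L * norm (fst u, snd u)"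
      using D by (intro deriv_bound) (simp add: euler_points_in_def)
    finally have "norm (fst (K (fst z, snd z) (fst u, snd u))) \<le> L * norm (fst u, snd u)" .
    then have "h * norm (fst (K (fst z, snd z) (fst u, snd u))) \<le> h * (L * norm u)"
      using h by (intro mult_left_mono) simp_all
    then show ?thesis
      using h by (simp add: iter_deriv_gap_def mult_ac)
  qed
  with L_nonneg show ?case by blast
next
  case (Suc n)
  then obtain B where B: "B \<ge> 0" "\<And>h z u. \<lbrakk>0 \<le> h; h \<le> 1; euler_points_in D G n h z\<rbrakk>
      \<Longrightarrow> norm (iter_deriv_gap n h z u) \<le> B * h ^ Suc n * norm u"
    by blast
  obtain C where C: "C \<ge> 0" "\<And>h z u. \<lbrakk>0 \<le> h; h \<le> 1; \<forall>k<n. (fst z, momentum_iter G h z k) \<in> D\<rbrakk>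
      \<Longrightarrow> norm (iter_deriv h z n u) \<le> C * norm u"
    using iter_deriv_bound [of n] by blast
  define B' where "B' = L * B + L * L ^ Suc n * (1 + C)"
  have "norm (iter_deriv_gap (Suc n) h z u) \<le> B' * h ^ Suc (Suc n) * norm u"
    if h: "0 \<le> h" "h \<le> 1" and pts: "euler_points_in D G (Suc n) h z" for h z u
  proof -
    let ?z = "\<lambda>k. (fst z, momentum_iter G h z k)" and ?u = "\<lambda>k. (fst u, iter_deriv h z k u)"
    have D: "?z (Suc n) \<in> D" "?z n \<in> D" "euler_points_in D G n h z"
      "\<forall>k\<le>n. (fst z, momentum_iter G h z k) \<in> D"
      using pts by (auto simp: euler_points_in_def simp del: momentum_iter.simps)
    have lin: "linear (K (?z (Suc n)))"
      using deriv [OF D(1)] by (rule has_derivative_linear)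
    have "norm (?u n) \<le> norm (fst u) + norm (iter_deriv h z n u)"
      by (rule norm_Pair_le)
    also have "\<dots> \<le> norm u + C * norm u"
      using C(2) [of h z u] h D by (intro add_mono) (auto simp: norm_fst_le_norm)
    finally have u_bound: "norm (?u n) \<le> (1 + C) * norm u" by (simp add: algebra_simps)
    have z_gap: "norm (?z (Suc n) - ?z n) \<le> (L * h) ^ Suc n"
      using iter_gap_bound [OF h(1) D(4)] by (simp add: norm_Pair del: momentum_iter.simps)
    have u_gap: "norm (?u (Suc n) - ?u n) \<le> B * h ^ Suc n * norm u"
      using B(2) [OF h D(3), of u]
      by (simp add: norm_Pair iter_deriv_gap_def del: iter_deriv.simps)
    have "K (?z (Suc n)) (?u (Suc n)) - K (?z n) (?u n)
        = K (?z (Suc n)) (?u (Suc n) - ?u n) + (K (?z (Suc n)) (?u n) - K (?z n) (?u n))"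
      by (simp only: linear_diff [OF lin]) simp
    then have "norm (K (?z (Suc n)) (?u (Suc n)) - K (?z n) (?u n))
        \<le> norm (K (?z (Suc n)) (?u (Suc n) - ?u n)) + norm (K (?z (Suc n)) (?u n) - K (?z n) (?u n))"
      by (metis norm_triangle_ineq)
    also have "\<dots> \<le> L * norm (?u (Suc n) - ?u n) + L * norm (?z (Suc n) - ?z n) * norm (?u n)"
      by (intro add_mono deriv_bound deriv_Lipschitz D)
    also have "\<dots> \<le> L * (B * h ^ Suc n * norm u) + L * (L * h) ^ Suc n * ((1 + C) * norm u)"
      using L_nonneg h C(1) by (intro add_mono mult_mono u_gap z_gap u_bound order_refl) auto
    also have "\<dots> = B' * h ^ Suc n * norm u"
      by (simp add: B'_def power_mult_distrib algebra_simps)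
    finally have "norm (K (?z (Suc n)) (?u (Suc n)) - K (?z n) (?u n)) \<le> B' * h ^ Suc n * norm u" .
    then have "h * norm (fst (K (?z (Suc n)) (?u (Suc n)) - K (?z n) (?u n))) \<le> h * (B' * h ^ Suc n * norm u)"
      using h(1) by (intro mult_left_mono order_trans [OF norm_fst_le_norm])
    moreover have "iter_deriv_gap (Suc n) h z u = - (h *\<^sub>R fst (K (?z (Suc n)) (?u (Suc n)) - K (?z n) (?u n)))"
      unfolding iter_deriv_gap_def iter_deriv.simps(2) [of h z "Suc n"] iter_deriv.simps(2) [of h z n u]
      by (simp add: scaleR_diff_right)
    ultimately show ?thesis using h by (simp add: mult_ac del: momentum_iter.simps iter_deriv.simps)
  qed
  moreover have "B' \<ge> 0" using B(1) C(1) L_nonneg by (simp add: B'_def)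
  ultimately show ?case by blast
qed

lemma euler_step_defect_bound:
  "\<exists>C\<ge>0. \<forall>h z u v. 0 \<le> h \<longrightarrow> h \<le> 1 \<longrightarrow> euler_points_in D G M h z \<longrightarrow>
     \<bar>symplectic_defect (euler_step G M h) z u v\<bar> \<le> C * h ^ (M + 1) * norm u * norm v"
proof -
  obtain C where C: "C \<ge> 0" "\<And>h z u. \<lbrakk>0 \<le> h; h \<le> 1; euler_points_in D G M h z\<rbrakk>
      \<Longrightarrow> norm (iter_deriv_gap M h z u) \<le> C * h ^ Suc M * norm u"
    using iter_deriv_gap_bound [of M] by blast
  have "\<bar>symplectic_defect (euler_step G M h) z u v\<bar> \<le> (2 * C) * h ^ (M + 1) * norm u * norm v"
    if h: "0 \<le> h" "h \<le> 1" "euler_points_in D G M h z" for h z u v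
  proof -
    have *: "\<bar>fst v \<bullet> iter_deriv_gap M h z u\<bar> \<le> C * h ^ (M + 1) * norm u * norm v" for u v :: "'a \<times> 'a"
    proof -
      have "\<bar>fst v \<bullet> iter_deriv_gap M h z u\<bar> \<le> norm (fst v) * norm (iter_deriv_gap M h z u)"
        by (rule Cauchy_Schwarz_ineq2)
      also have "\<dots> \<le> norm v * (C * h ^ Suc M * norm u)"
        by (intro mult_mono C(2) h norm_fst_le_norm) auto
      finally show ?thesis by (simp add: mult_ac)
    qed
    show ?thesis
      unfolding euler_step_defect [OF h(3)] using * [of v u] * [of u v] by (simp add: mult_ac)
  qed
  then show ?thesis using C(1) by (intro exI [of _ "2 * C"]) auto
qed

lemma euler_step_defect_vertical:
  assumes "euler_points_in D G M h z" "fst u = 0" "fst v = 0"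
  shows "symplectic_defect (euler_step G M h) z u v = 0"
  using assms by (simp add: euler_step_defect)

lemma euler_step_deriv_bound:
  "\<exists>C\<ge>0. \<forall>h z u. 0 \<le> h \<longrightarrow> h \<le> 1 \<longrightarrow> euler_points_in D G M h z \<longrightarrow>
     norm (frechet_derivative (euler_step G M h) (at z) u) \<le> C * norm u"
proof -
  obtain C where C: "C \<ge> 0" "\<And>h z u. \<lbrakk>0 \<le> h; h \<le> 1; \<forall>k<M. (fst z, momentum_iter G h z k) \<in> D\<rbrakk>
      \<Longrightarrow> norm (iter_deriv h z M u) \<le> C * norm u"
    using iter_deriv_bound [of M] by blast
  have "norm (frechet_derivative (euler_step G M h) (at z) u) \<le> (1 + L * (1 + C) + C) * norm u"
    if h: "0 \<le> h" "h \<le> 1" and pts: "euler_points_in D G M h z" for h z u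
  proof -
    have D: "(fst z, momentum_iter G h z M) \<in> D" "\<forall>k<M. (fst z, momentum_iter G h z k) \<in> D"
      using pts by (auto simp: euler_points_in_def)
    let ?K = "K (fst z, momentum_iter G h z M) (fst u, iter_deriv h z M u)"
    note iter = C(2) [OF h D(2), of u]
    have "norm (fst u, iter_deriv h z M u) \<le> norm (fst u) + norm (iter_deriv h z M u)"
      by (rule norm_Pair_le)
    also have "\<dots> \<le> norm u + C * norm u"
      using iter by (intro add_mono) (auto simp: norm_fst_le_norm)
    finally have "L * norm (fst u, iter_deriv h z M u) \<le> L * ((1 + C) * norm u)"
      using L_nonneg by (intro mult_left_mono) (auto simp: algebra_simps)
    then have K: "norm ?K \<le> L * ((1 + C) * norm u)"
      using deriv_bound [OF D(1)] by (meson order_trans)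
    have "norm (step_deriv M h z u) \<le> norm (fst u + h *\<^sub>R snd ?K) + norm (iter_deriv h z M u)"
      unfolding step_deriv_def by (rule norm_Pair_le)
    also have "\<dots> \<le> (norm (fst u) + \<bar>h\<bar> * norm (snd ?K)) + norm (iter_deriv h z M u)"
      using norm_triangle_ineq [of "fst u" "h *\<^sub>R snd ?K"] by simp
    also have "\<dots> \<le> (norm u + 1 * norm ?K) + C * norm u"
      using h iter by (intro add_mono mult_mono norm_fst_le_norm norm_snd_le_norm) auto
    finally show ?thesis
      using K frechet_derivative_at [OF euler_step_has_derivative [OF pts]]
      by (simp add: algebra_simps)
  qed
  moreover have "1 + L * (1 + C) + C \<ge> 0" using C(1) L_nonneg by simp
  ultimately show ?thesis by blast
qed

end

section \<open>Duality and the composed scheme\<close>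

text \<open>
For \<open>G = (H\<^sub>q, H\<^sub>p)\<close> this is the gradient field of \<open>(a, b) \<mapsto> - H(b, a)\<close>. The sign compensates the
reversal of the canonical form under the exchange of \<open>q\<close> and \<open>p\<close>, and the \<open>p\<close>-implicit scheme
for the dual field is the \<open>q\<close>-implicit scheme for the original one.
\<close>
definition dual_field :: "('a::real_normed_vector \<times> 'a \<Rightarrow> 'a \<times> 'a) \<Rightarrow> 'a \<times> 'a \<Rightarrow> 'a \<times> 'a" where
  "dual_field G z = - swap_conj G z"

lemma dual_field_dual_field [simp]: "dual_field (dual_field G) = G"
  by (simp add: dual_field_def swap_conj_def fun_eq_iff prod_eq_iff)

context gradient_field
begin

lemma dual: "gradient_field (dual_field G) (\<lambda>z u. - swap_conj (K (prod.swap z)) u) (prod.swap ` D) L"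
proof
  show "convex (prod.swap ` D)"
    using convex bounded_linear.linear [OF bounded_linear_swap] by (intro convex_linear_image)
next
  fix z assume "z \<in> prod.swap ` D"
  then have z: "prod.swap z \<in> D" by auto
  show "(dual_field G has_derivative (\<lambda>u. - swap_conj (K (prod.swap z)) u)) (at z)"
    unfolding dual_field_def [abs_def]
    by (intro has_derivative_minus swap_conj_has_derivative deriv z)
  show "norm (dual_field G z) \<le> L"
    using bound [OF z] by (simp add: dual_field_def swap_conj_def)
  show "norm (- swap_conj (K (prod.swap z)) u) \<le> L * norm u" for u
    using deriv_bound [OF z, of "prod.swap u"] by (simp add: swap_conj_def)
  show "- swap_conj (K (prod.swap z)) u \<bullet> v = u \<bullet> - swap_conj (K (prod.swap z)) v" for u v
    using symmetric [OF z, of "prod.swap u" "prod.swap v"] by (simp add: swap_conj_def inner_prod_def)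
next
  fix z w u assume "z \<in> prod.swap ` D" "w \<in> prod.swap ` D"
  then have zw: "prod.swap z \<in> D" "prod.swap w \<in> D" by auto
  have "norm (- swap_conj (K (prod.swap z)) u - - swap_conj (K (prod.swap w)) u)
      = norm (prod.swap (K (prod.swap z) (prod.swap u) - K (prod.swap w) (prod.swap u)))"
    by (simp add: swap_conj_def norm_prod_def norm_minus_commute)
  also have "\<dots> \<le> L * norm (prod.swap z - prod.swap w) * norm (prod.swap u)"
    by (subst norm_swap) (rule deriv_Lipschitz [OF zw])
  also have "prod.swap z - prod.swap w = prod.swap (z - w)"
    by (simp add: prod_eq_iff)
  finally show "norm (- swap_conj (K (prod.swap z)) u - - swap_conj (K (prod.swap w)) u)
      \<le> L * norm (z - w) * norm u"
    by simp
qed (rule L_nonneg)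

end

text \<open>
Duality also covers the second composition: conjugating the scheme of the dual field with the
exchange of \<open>q\<close> and \<open>p\<close> gives the composition in the opposite order.
\<close>
definition verlet ::
    "('a::real_normed_vector \<times> 'a \<Rightarrow> 'a \<times> 'a) \<Rightarrow> nat \<Rightarrow> nat \<Rightarrow> real \<Rightarrow> 'a \<times> 'a \<Rightarrow> 'a \<times> 'a" where
  "verlet G M1 M2 h = swap_conj (euler_step (dual_field G) M2 (h / 2)) \<circ> euler_step G M1 (h / 2)"

definition verlet_points_in ::
    "('a::real_normed_vector \<times> 'a) set \<Rightarrow> ('a \<times> 'a \<Rightarrow> 'a \<times> 'a) \<Rightarrow> nat \<Rightarrow> nat \<Rightarrow> real \<Rightarrow> 'a \<times> 'a \<Rightarrow> bool" where
  "verlet_points_in D G M1 M2 h z \<longleftrightarrow>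
     euler_points_in D G M1 (h / 2) z \<and>
     euler_points_in (prod.swap ` D) (dual_field G) M2 (h / 2) (prod.swap (euler_step G M1 (h / 2) z))"

context gradient_field
begin

lemma verlet_differentiable:
  assumes "verlet_points_in D G M1 M2 h z"
  shows "verlet G M1 M2 h differentiable (at z)"
  unfolding verlet_def
  using assms euler_step_differentiable gradient_field.euler_step_differentiable [OF dual]
  by (intro differentiable_chain_at swap_conj_differentiable) (auto simp: verlet_points_in_def)

text \<open>
The defects of the two half steps add up. The first one, of order \<open>h^(M1 + 1)\<close>, vanishes when
both arguments point in the direction of \<open>p\<close>, so that only the order of the second half step
matters there. The second defect is evaluated on the images of the arguments under the
derivative of the first half step, which mixes \<open>q\<close> and \<open>p\<close> but is uniformly bounded.
\<close>
lemma verlet_defect_bound: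
  "\<exists>C\<ge>0. \<forall>h z u v. 0 \<le> h \<longrightarrow> h \<le> 1 \<longrightarrow> verlet_points_in D G M1 M2 h z \<longrightarrow>
     \<bar>symplectic_defect (verlet G M1 M2 h) z u v\<bar> \<le> C * h ^ (min M1 M2 + 1) * norm u * norm v \<and>
     (fst u = 0 \<longrightarrow> fst v = 0 \<longrightarrow>
        \<bar>symplectic_defect (verlet G M1 M2 h) z u v\<bar> \<le> C * h ^ (M2 + 1) * norm u * norm v)"
proof -
  interpret dual: gradient_field "dual_field G" "\<lambda>z u. - swap_conj (K (prod.swap z)) u" "prod.swap ` D" L
    by (rule dual)
  obtain C1 where C1: "C1 \<ge> 0" "\<And>h z u v. \<lbrakk>0 \<le> h; h \<le> 1; euler_points_in D G M1 h z\<rbrakk> \<Longrightarrow>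
      \<bar>symplectic_defect (euler_step G M1 h) z u v\<bar> \<le> C1 * h ^ (M1 + 1) * norm u * norm v"
    using euler_step_defect_bound [of M1] by blast
  obtain C2 where C2: "C2 \<ge> 0"
    "\<And>h z u v. \<lbrakk>0 \<le> h; h \<le> 1; euler_points_in (prod.swap ` D) (dual_field G) M2 h z\<rbrakk> \<Longrightarrow>
      \<bar>symplectic_defect (euler_step (dual_field G) M2 h) z u v\<bar> \<le> C2 * h ^ (M2 + 1) * norm u * norm v"
    using dual.euler_step_defect_bound [of M2] by blast
  obtain B where B: "B \<ge> 0" "\<And>h z u. \<lbrakk>0 \<le> h; h \<le> 1; euler_points_in D G M1 h z\<rbrakk> \<Longrightarrow>
      norm (frechet_derivative (euler_step G M1 h) (at z) u) \<le> B * norm u"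
    using euler_step_deriv_bound [of M1] by blast
  define C where "C = C1 + C2 * B\<^sup>2"
  have "\<bar>symplectic_defect (verlet G M1 M2 h) z u v\<bar> \<le> C * h ^ (min M1 M2 + 1) * norm u * norm v \<and>
     (fst u = 0 \<longrightarrow> fst v = 0 \<longrightarrow>
        \<bar>symplectic_defect (verlet G M1 M2 h) z u v\<bar> \<le> C * h ^ (M2 + 1) * norm u * norm v)"
    if h: "0 \<le> h" "h \<le> 1" and pts: "verlet_points_in D G M1 M2 h z" for h z u v
  proof -
    let ?T = "euler_step G M1 (h / 2)" and ?S = "euler_step (dual_field G) M2 (h / 2)"
    have p1: "euler_points_in D G M1 (h / 2) z"
      and p2: "euler_points_in (prod.swap ` D) (dual_field G) M2 (h / 2) (prod.swap (?T z))"
      using pts by (auto simp: verlet_points_in_def)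
    have h2: "0 \<le> h / 2" "h / 2 \<le> 1" "h / 2 \<le> h" using h by auto
    let ?u = "frechet_derivative ?T (at z) u" and ?v = "frechet_derivative ?T (at z) v"
    have split: "symplectic_defect (verlet G M1 M2 h) z u v =
        symplectic_defect ?T z u v - symplectic_defect ?S (prod.swap (?T z)) (prod.swap ?u) (prod.swap ?v)"
      unfolding verlet_def
      using euler_step_differentiable [OF p1] dual.euler_step_differentiable [OF p2]
      by (simp add: symplectic_defect_compose swap_conj_differentiable symplectic_defect_swap_conj)
    have first: "\<bar>symplectic_defect ?T z u v\<bar> \<le> C1 * (h / 2) ^ (M1 + 1) * norm u * norm v"
      by (rule C1(2) [OF h2(1,2) p1])
    have "\<bar>symplectic_defect ?S (prod.swap (?T z)) (prod.swap ?u) (prod.swap ?v)\<bar>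
        \<le> C2 * (h / 2) ^ (M2 + 1) * norm ?u * norm ?v"
      using C2(2) [OF h2(1,2) p2, of "prod.swap ?u" "prod.swap ?v"] by simp
    also have "\<dots> \<le> C2 * h ^ (M2 + 1) * (B * norm u) * (B * norm v)"
      using C2(1) B h2 p1 by (intro mult_mono power_mono B(2)) (auto intro!: mult_nonneg_nonneg)
    also have "\<dots> = C2 * B\<^sup>2 * (h ^ (M2 + 1) * norm u * norm v)"
      by (simp add: power2_eq_square mult_ac)
    finally have second: "\<bar>symplectic_defect ?S (prod.swap (?T z)) (prod.swap ?u) (prod.swap ?v)\<bar>
        \<le> C2 * B\<^sup>2 * (h ^ (M2 + 1) * norm u * norm v)" .
    have "C1 * (h / 2) ^ (M1 + 1) * norm u * norm v \<le> C1 * h ^ (min M1 M2 + 1) * norm u * norm v"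
    proof (intro mult_right_mono mult_left_mono C1(1) norm_ge_zero)
      have "(h / 2) ^ (M1 + 1) \<le> h ^ (M1 + 1)" using h2 by (intro power_mono)
      also have "\<dots> \<le> h ^ (min M1 M2 + 1)" using h by (intro power_decreasing) auto
      finally show "(h / 2) ^ (M1 + 1) \<le> h ^ (min M1 M2 + 1)" .
    qed
    moreover have "C2 * B\<^sup>2 * (h ^ (M2 + 1) * norm u * norm v)
        \<le> C2 * B\<^sup>2 * (h ^ (min M1 M2 + 1) * norm u * norm v)"
      using h C2(1) by (intro mult_left_mono mult_right_mono power_decreasing) auto
    ultimately have "\<bar>symplectic_defect (verlet G M1 M2 h) z u v\<bar>
        \<le> C * h ^ (min M1 M2 + 1) * norm u * norm v"
      using split first second by (simp add: C_def algebra_simps)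
    moreover have "\<bar>symplectic_defect (verlet G M1 M2 h) z u v\<bar> \<le> C * h ^ (M2 + 1) * norm u * norm v"
      if "fst u = 0" "fst v = 0"
    proof -
      have "symplectic_defect ?T z u v = 0" using p1 that by (rule euler_step_defect_vertical)
      then have "\<bar>symplectic_defect (verlet G M1 M2 h) z u v\<bar> \<le> C2 * B\<^sup>2 * (h ^ (M2 + 1) * norm u * norm v)"
        using split second by simp
      also have "\<dots> \<le> C * (h ^ (M2 + 1) * norm u * norm v)"
        using C1(1) h by (intro mult_right_mono) (auto simp: C_def)
      finally show ?thesis by (simp add: mult_ac)
    qed
    ultimately show ?thesis by blast
  qed
  moreover have "C \<ge> 0" using C1(1) C2(1) by (simp add: C_def)
  ultimately show ?thesis by blast
qed

end

section \<open>Jacobian matrices in block form\<close>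

lemma sum_UNIV_Plus:
  fixes f :: "'a::finite + 'b::finite \<Rightarrow> 'c::comm_monoid_add"
  shows "(\<Sum>k\<in>UNIV. f k) = (\<Sum>i\<in>UNIV. f (Inl i)) + (\<Sum>j\<in>UNIV. f (Inr j))"
  by (simp add: UNIV_Plus_UNIV [symmetric] sum.Plus del: UNIV_Plus_UNIV)

lemma vec_of_phase_nth [simp]:
  "vec_of_phase z $ Inl i = fst z $ i" "vec_of_phase z $ Inr i = snd z $ i"
  by (simp_all add: vec_of_phase_def)

lemma inner_vec_of_phase: "vec_of_phase u \<bullet> vec_of_phase v = u \<bullet> v"
  by (simp add: inner_vec_def sum_UNIV_Plus inner_prod_def)

lemma J_mat_vec_of_phase: "J_mat *v vec_of_phase v = vec_of_phase (snd v, - fst v)"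
proof -
  have "(J_mat *v vec_of_phase v) $ k = vec_of_phase (snd v, - fst v) $ k" for k
    by (cases k) (simp_all add: J_mat_def block_mat_def matrix_vector_mult_def sum_UNIV_Plus mat_def
        if_distrib [of "\<lambda>x. x * _"] sum_negf cong: if_cong)
  then show ?thesis by (simp add: vec_eq_iff)
qed

lemma linear_vec_of_phase: "linear vec_of_phase"
  by (rule linearI) (auto simp: vec_of_phase_def vec_eq_iff split: sum.split)

lemma linear_phase_of_vec: "linear phase_of_vec"
  by (rule linearI) (auto simp: phase_of_vec_def vec_eq_iff)

lemma axis_eq_vec_of_phase:
  "axis (Inl i) 1 = vec_of_phase (axis i 1, 0)" "axis (Inr i) 1 = vec_of_phase (0, axis i 1)"
  by (auto simp: vec_eq_iff vec_of_phase_def axis_def split: sum.split)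

lemma phase_jacobian_mult:
  assumes "T differentiable (at z)"
  shows "phase_jacobian T z *v vec_of_phase u = vec_of_phase (frechet_derivative T (at z) u)"
proof -
  let ?T' = "frechet_derivative T (at z)"
  have phase: "(phase_of_vec has_derivative phase_of_vec) (at x)"
    and vec: "(vec_of_phase has_derivative vec_of_phase) (at y)" for x :: "real ^ ('a + 'a)" and y :: "'a phase"
    using linear_phase_of_vec linear_vec_of_phase
    by (auto simp: linear_linear intro: bounded_linear_imp_has_derivative)
  have "(T has_derivative ?T') (at (phase_of_vec (vec_of_phase z)))"
    using assms by (simp flip: frechet_derivative_works)
  from has_derivative_compose [OF phase this]
  have "((\<lambda>x. vec_of_phase (T (phase_of_vec x))) has_derivative
      (\<lambda>x. vec_of_phase (?T' (phase_of_vec x)))) (at (vec_of_phase z))"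
    using has_derivative_compose [OF _ vec] by blast
  then show ?thesis
    using jacobian_works [of "\<lambda>x. vec_of_phase (T (phase_of_vec x))" "at (vec_of_phase z)"]
    by (auto simp: phase_jacobian_def differentiable_def dest: has_derivative_unique fun_cong)
qed

text \<open>
Reading off entries by testing with basis vectors reduces identities of \<open>2N \<times> 2N\<close> matrices to
identities of bilinear forms on phase space.
\<close>
lemma matrix_nth_eq_inner: "A $ i $ j = axis i 1 \<bullet> (A *v axis j (1::real))"
  by (simp add: inner_axis' matrix_vector_mult_basis column_def)

lemma pullback_of_J_mat:
  assumes "T differentiable (at z)"
  shows "vec_of_phase u \<bullet> ((transpose (phase_jacobian T z) ** J_mat ** phase_jacobian T z) *v vec_of_phase v)
    = canonical_form (frechet_derivative T (at z) u) (frechet_derivative T (at z) v)"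
proof -
  have "vec_of_phase u \<bullet> ((transpose (phase_jacobian T z) ** J_mat ** phase_jacobian T z) *v vec_of_phase v)
    = (phase_jacobian T z *v vec_of_phase u) \<bullet> (J_mat *v (phase_jacobian T z *v vec_of_phase v))"
    by (simp only: matrix_vector_mul_assoc [symmetric]) (metis dot_lmul_matrix vector_transpose_matrix)
  then show ?thesis
    by (simp add: phase_jacobian_mult [OF assms] J_mat_vec_of_phase inner_vec_of_phase canonical_form_def
        inner_prod_def)
qed

definition defect_block ::
    "(real ^ 'n \<Rightarrow> 'n phase) \<Rightarrow> (real ^ 'n \<Rightarrow> 'n phase) \<Rightarrow> ('n phase \<Rightarrow> 'n phase) \<Rightarrow> 'n phase \<Rightarrow> real ^ 'n ^ 'n::finite"
  where "defect_block s t T z = (\<chi> i j. symplectic_defect T z (s (axis i 1)) (t (axis j 1)))"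

abbreviation q_dir :: "real ^ 'n \<Rightarrow> 'n phase" where "q_dir x \<equiv> (x, 0)"
abbreviation p_dir :: "real ^ 'n \<Rightarrow> 'n phase" where "p_dir x \<equiv> (0, x)"

lemma jacobian_defect_blocks:
  assumes "T differentiable (at z)"
  shows "transpose (phase_jacobian T z) ** J_mat ** phase_jacobian T z = J_mat +
    block_mat (defect_block q_dir q_dir T z) (defect_block q_dir p_dir T z)
      (defect_block p_dir q_dir T z) (defect_block p_dir p_dir T z)"
proof -
  have J: "J_mat $ i $ j = axis i 1 \<bullet> (J_mat *v axis j 1)" for i j :: "'a + 'a"
    by (rule matrix_nth_eq_inner)
  have "(transpose (phase_jacobian T z) ** J_mat ** phase_jacobian T z) $ i $ j = (J_mat +
    block_mat (defect_block q_dir q_dir T z) (defect_block q_dir p_dir T z)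
      (defect_block p_dir q_dir T z) (defect_block p_dir p_dir T z)) $ i $ j" for i j
    unfolding matrix_nth_eq_inner [of "transpose _ ** _ ** _"] vector_add_component J
    by (cases i; cases j)
      (simp_all add: axis_eq_vec_of_phase pullback_of_J_mat [OF assms] J_mat_vec_of_phase inner_vec_of_phase
        block_mat_def defect_block_def symplectic_defect_def canonical_form_def inner_prod_def)
  then show ?thesis by (simp add: vec_eq_iff)
qed

lemma norm_matrix_le_of_entries:
  fixes A :: "real ^ 'n ^ 'm"
  assumes "\<And>i j. \<bar>A $ i $ j\<bar> \<le> B"
  shows "norm A \<le> real CARD('m) * (real CARD('n) * B)"
proof -
  have "norm A \<le> (\<Sum>i\<in>UNIV. norm (A $ i))"
    unfolding norm_vec_def [of A] by (rule L2_set_le_sum) simp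
  also have "\<dots> \<le> (\<Sum>i\<in>(UNIV :: 'm set). real CARD('n) * B)"
  proof (rule sum_mono)
    fix i
    have "norm (A $ i) \<le> (\<Sum>j\<in>UNIV. \<bar>A $ i $ j\<bar>)" by (rule norm_le_l1_cart)
    also have "\<dots> \<le> (\<Sum>j\<in>(UNIV :: 'n set). B)" by (intro sum_mono assms)
    finally show "norm (A $ i) \<le> real CARD('n) * B" by simp
  qed
  finally show ?thesis by simp
qed

lemma order_with_defect_block:
  fixes s t :: "real ^ 'n::finite \<Rightarrow> 'n phase"
  assumes "\<And>h z i j. \<lbrakk>0 < h; h \<le> h0; h \<le> 1; z \<in> S\<rbrakk> \<Longrightarrow>
      \<bar>symplectic_defect (T h) z (s (axis i 1)) (t (axis j 1))\<bar> \<le> B * h ^ r"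
    and "real CARD('n) * (real CARD('n) * B) \<le> C"
  shows "order_with C S h0 r (\<lambda>h. defect_block s t (T h))"
  unfolding order_with_def
proof (intro exI [of _ 1] conjI allI impI ballI)
  fix h z assume h: "0 < h \<and> h \<le> h0 \<and> h < 1" and z: "z \<in> S"
  have "norm (defect_block s t (T h) z) \<le> real CARD('n) * (real CARD('n) * (B * h ^ r))"
    using h z by (intro norm_matrix_le_of_entries) (simp add: defect_block_def assms(1))
  also have "\<dots> \<le> C * h ^ r"
    using assms(2) h mult_right_mono [of "real CARD('n) * (real CARD('n) * B)" C "h ^ r"] by (simp add: mult_ac)
  finally show "norm (defect_block s t (T h) z) \<le> C * h ^ r" .
qed simp

section \<open>The schemes of a Hamiltonian\<close>

text \<open>
The partial gradients are defined by definite description, so they are meaningful only where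
\<open>H\<close> is differentiable. The identification of the two Euler schemes below holds at every point
nevertheless, since it is an identity between terms in these gradients.
\<close>
definition phase_gradient :: "('n::finite phase \<Rightarrow> real) \<Rightarrow> 'n phase \<Rightarrow> 'n phase" where
  "phase_gradient H z = (grad_q H z, grad_p H z)"

lemma phase_gradient_eqI:
  fixes H :: "'n::finite phase \<Rightarrow> real"
  assumes "GDERIV H z :> g"
  shows "phase_gradient H z = g"
proof -
  have H: "(H has_derivative (\<lambda>u. u \<bullet> g)) (at (fst z, snd z))"
    using assms by (simp add: gderiv_def)
  have "((\<lambda>x. (x, snd z)) has_derivative (\<lambda>x. (x, 0))) (at (fst z))"
    by (auto intro!: derivative_eq_intros)
  from has_derivative_compose [OF this H] have "GDERIV (\<lambda>x. H (x, snd z)) (fst z) :> fst g"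
    by (simp add: gderiv_def inner_prod_def)
  moreover have "((\<lambda>y. (fst z, y)) has_derivative (\<lambda>y. (0, y))) (at (snd z))"
    by (auto intro!: derivative_eq_intros)
  from has_derivative_compose [OF this H] have "GDERIV (\<lambda>y. H (fst z, y)) (snd z) :> snd g"
    by (simp add: gderiv_def inner_prod_def)
  ultimately show ?thesis
    by (simp add: phase_gradient_def grad_q_def grad_p_def gradient_eqI)
qed

lemma smooth_near_imp_gradient_field:
  fixes H :: "'n::finite phase \<Rightarrow> real"
  assumes "compact D" "convex D" "smooth_near H D"
  shows "\<exists>K L. gradient_field (phase_gradient H) K D L"
proof -
  obtain U G K L where U: "open U" "D \<subseteq> U" and L: "L \<ge> 0"
    and grad: "\<And>x. x \<in> U \<Longrightarrow> GDERIV H x :> G x"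
    and G': "\<And>x. x \<in> U \<Longrightarrow> (G has_derivative K x) (at x)"
    and sym: "\<And>x u v. x \<in> U \<Longrightarrow> K x u \<bullet> v = u \<bullet> K x v"
    and bounds: "\<And>x. x \<in> D \<Longrightarrow> norm (G x) \<le> L" "\<And>x u. x \<in> D \<Longrightarrow> norm (K x u) \<le> L * norm u"
      "\<And>x y u. \<lbrakk>x \<in> D; y \<in> D\<rbrakk> \<Longrightarrow> norm (K x u - K y u) \<le> L * norm (x - y) * norm u"
    by (rule smooth_near_imp_regular_gradient [OF assms]) (rule that)
  have eq: "phase_gradient H x = G x" if "x \<in> U" for x
    using grad [OF that] by (rule phase_gradient_eqI)
  have "gradient_field (phase_gradient H) K D L"
  proof
    fix z assume z: "z \<in> D"
    then have "z \<in> U" using U by auto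
    then show "(phase_gradient H has_derivative K z) (at z)"
      using has_derivative_transform_within_open [OF G' U(1)] eq by simp
    show "K z u \<bullet> v = u \<bullet> K z v" for u v using sym \<open>z \<in> U\<close> .
    show "norm (phase_gradient H z) \<le> L" using bounds(1) [OF z] eq \<open>z \<in> U\<close> by simp
  qed (use assms(2) L bounds in auto)
  then show ?thesis by blast
qed

lemma p_iter_eq_momentum_iter: "p_iter H h q p n = momentum_iter (phase_gradient H) h (q, p) n"
  by (induction n) (simp_all add: phase_gradient_def)

lemma q_iter_eq_momentum_iter:
  "q_iter H h q p n = momentum_iter (dual_field (phase_gradient H)) h (p, q) n"
  by (induction n) (simp_all add: phase_gradient_def dual_field_def swap_conj_def)

lemma Phi_eq_euler_step: "Phi H M h = euler_step (phase_gradient H) M h"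
  by (simp add: fun_eq_iff Phi_def euler_step_def p_iter_eq_momentum_iter Let_def phase_gradient_def)

lemma Psi_eq_euler_step: "Psi H M h = swap_conj (euler_step (dual_field (phase_gradient H)) M h)"
  by (simp add: fun_eq_iff Psi_def euler_step_def q_iter_eq_momentum_iter Let_def phase_gradient_def
      dual_field_def swap_conj_def)

lemma Upsilon_eq_verlet: "Upsilon H M1 M2 h = verlet (phase_gradient H) M1 M2 h"
  by (simp add: Upsilon_def verlet_def Phi_eq_euler_step Psi_eq_euler_step)

lemma Lambda_eq_verlet: "Lambda H M1 M2 h = swap_conj (verlet (dual_field (phase_gradient H)) M1 M2 h)"
  by (simp add: Lambda_def verlet_def swap_conj_compose Phi_eq_euler_step Psi_eq_euler_step)

lemma Phi_stays_in_imp_euler_points_in: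
  "Phi_stays_in D H M h z \<Longrightarrow> euler_points_in D (phase_gradient H) M h z"
  by (simp add: Phi_stays_in_def euler_points_in_def p_iter_eq_momentum_iter)

lemma Psi_stays_in_imp_euler_points_in:
  "Psi_stays_in D H M h z \<Longrightarrow>
    euler_points_in (prod.swap ` D) (dual_field (phase_gradient H)) M h (prod.swap z)"
  by (auto simp: Psi_stays_in_def euler_points_in_def q_iter_eq_momentum_iter prod.swap_def [of z])

lemma Upsilon_admissible_imp_verlet_points_in:
  "\<lbrakk>Upsilon_admissible D H M1 M2 S h0; 0 < h; h \<le> h0; z \<in> S\<rbrakk> \<Longrightarrow>
    verlet_points_in D (phase_gradient H) M1 M2 h z"
  unfolding verlet_points_in_def Upsilon_admissible_def Phi_eq_euler_step [symmetric]
  by (blast intro: Phi_stays_in_imp_euler_points_in Psi_stays_in_imp_euler_points_in)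

lemma Lambda_admissible_imp_verlet_points_in:
  assumes "Lambda_admissible D H M1 M2 S h0" "0 < h" "h \<le> h0" "z \<in> S"
  shows "verlet_points_in (prod.swap ` D) (dual_field (phase_gradient H)) M1 M2 h (prod.swap z)"
proof -
  have "Psi_stays_in D H M1 (h / 2) z" "Phi_stays_in D H M2 (h / 2) (Psi H M1 (h / 2) z)"
    using assms by (auto simp: Lambda_admissible_def)
  then show ?thesis
    using Psi_stays_in_imp_euler_points_in [of D H M1 "h / 2" z]
      Phi_stays_in_imp_euler_points_in [of D H M2 "h / 2" "Psi H M1 (h / 2) z"]
    by (simp add: verlet_points_in_def Psi_eq_euler_step swap_conj_def image_image)
qed

text \<open>
The factor \<open>N\<^sup>2\<close> in the constant passes from bounds on entries to bounds on the norms of blocks.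
The constant arises from \<open>H\<close>, \<open>D\<close>, \<open>M1\<close>, \<open>M2\<close> alone, because the defect estimates hold for all
\<open>h \<le> 1\<close> and all admissible points simultaneously.
\<close>
theorem corollary6:
  fixes H :: "(real ^ 'n::finite) \<times> (real ^ 'n) \<Rightarrow> real"
    and D :: "((real ^ 'n) \<times> (real ^ 'n)) set"
    and M1 M2 :: nat
  assumes "compact D" and "convex D"
    and "smooth_near H D"
    and "M1 \<ge> 1" and "M2 \<ge> 1"
  shows "\<exists>C. \<forall>S h0. S \<subseteq> D \<and> h0 > 0 \<longrightarrow>
    (Upsilon_admissible D H M1 M2 S h0 \<longrightarrow>
      (\<exists>P11 P12 P21 P22.
        (\<forall>h. 0 < h \<and> h \<le> h0 \<longrightarrow> (\<forall>z\<in>S.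
          Upsilon H M1 M2 h differentiable (at z) \<and>
          transpose (phase_jacobian (Upsilon H M1 M2 h) z) ** J_mat **
            phase_jacobian (Upsilon H M1 M2 h) z
          = J_mat + block_mat (P11 h z) (P12 h z) (P21 h z) (P22 h z))) \<and>
        order_with C S h0 (min M1 M2 + 1) P11 \<and>
        order_with C S h0 (min M1 M2 + 1) P12 \<and>
        order_with C S h0 (min M1 M2 + 1) P21 \<and>
        order_with C S h0 (M2 + 1) P22)) \<and>
    (Lambda_admissible D H M1 M2 S h0 \<longrightarrow>
      (\<exists>P11 P12 P21 P22.
        (\<forall>h. 0 < h \<and> h \<le> h0 \<longrightarrow> (\<forall>z\<in>S.
          Lambda H M1 M2 h differentiable (at z) \<and>
          transpose (phase_jacobian (Lambda H M1 M2 h) z) ** J_mat **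
            phase_jacobian (Lambda H M1 M2 h) z
          = J_mat + block_mat (P11 h z) (P12 h z) (P21 h z) (P22 h z))) \<and>
        order_with C S h0 (M2 + 1) P11 \<and>
        order_with C S h0 (min M1 M2 + 1) P12 \<and>
        order_with C S h0 (min M1 M2 + 1) P21 \<and>
        order_with C S h0 (min M1 M2 + 1) P22))"
proof -
  let ?G = "phase_gradient H"
  let ?U = "Upsilon H M1 M2" and ?L = "Lambda H M1 M2" and ?V = "verlet (dual_field ?G) M1 M2"
  obtain K L where "gradient_field ?G K D L"
    using smooth_near_imp_gradient_field assms(1-3) by blast
  then interpret gradient_field ?G K D L .
  interpret dual: gradient_field "dual_field ?G" "\<lambda>z u. - swap_conj (K (prod.swap z)) u" "prod.swap ` D" L
    by (rule dual)
  obtain A where A: "A \<ge> 0"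
    "\<And>h z u v. \<lbrakk>0 \<le> h; h \<le> 1; verlet_points_in D ?G M1 M2 h z\<rbrakk> \<Longrightarrow>
      \<bar>symplectic_defect (verlet ?G M1 M2 h) z u v\<bar> \<le> A * h ^ (min M1 M2 + 1) * norm u * norm v"
    "\<And>h z u v. \<lbrakk>0 \<le> h; h \<le> 1; verlet_points_in D ?G M1 M2 h z; fst u = 0; fst v = 0\<rbrakk> \<Longrightarrow>
      \<bar>symplectic_defect (verlet ?G M1 M2 h) z u v\<bar> \<le> A * h ^ (M2 + 1) * norm u * norm v"
    using verlet_defect_bound [of M1 M2] by blast
  obtain B where B: "B \<ge> 0"
    "\<And>h z u v. \<lbrakk>0 \<le> h; h \<le> 1; verlet_points_in (prod.swap ` D) (dual_field ?G) M1 M2 h z\<rbrakk> \<Longrightarrow>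
      \<bar>symplectic_defect (?V h) z u v\<bar> \<le> B * h ^ (min M1 M2 + 1) * norm u * norm v"
    "\<And>h z u v. \<lbrakk>0 \<le> h; h \<le> 1; verlet_points_in (prod.swap ` D) (dual_field ?G) M1 M2 h z;
        fst u = 0; fst v = 0\<rbrakk> \<Longrightarrow>
      \<bar>symplectic_defect (?V h) z u v\<bar> \<le> B * h ^ (M2 + 1) * norm u * norm v"
    using dual.verlet_defect_bound [of M1 M2] by blast
  define N where "N = real CARD('n) * real CARD('n)"
  define C where "C = N * A + N * B"
  have C: "real CARD('n) * (real CARD('n) * A) \<le> C" "real CARD('n) * (real CARD('n) * B) \<le> C"
    using A(1) B(1) by (simp_all add: C_def N_def mult.assoc)
  have unit: "norm (axis i 1 :: real ^ 'n, 0 :: real ^ 'n) = 1"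
    "norm (0 :: real ^ 'n, axis i 1 :: real ^ 'n) = 1" for i :: 'n
    by (simp_all add: norm_Pair)
  show ?thesis
  proof (intro exI [of _ C] allI impI conjI)
    fix S :: "'n phase set" and h0 :: real
    assume adm: "Upsilon_admissible D H M1 M2 S h0"
    have pts: "verlet_points_in D ?G M1 M2 h z" if "0 < h" "h \<le> h0" "z \<in> S" for h z
      using adm that by (rule Upsilon_admissible_imp_verlet_points_in)
    have diff: "?U h differentiable (at z)" if "0 < h" "h \<le> h0" "z \<in> S" for h z
      unfolding Upsilon_eq_verlet by (intro verlet_differentiable pts that)
    have defect: "\<bar>symplectic_defect (?U h) z u v\<bar> \<le> A * h ^ (min M1 M2 + 1)"
      if "0 < h" "h \<le> h0" "h \<le> 1" "z \<in> S" "norm u = 1" "norm v = 1" for h z u v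
      using A(2) [of h z u v] pts [of h z] that by (simp add: Upsilon_eq_verlet)
    have defect_p: "\<bar>symplectic_defect (?U h) z u v\<bar> \<le> A * h ^ (M2 + 1)"
      if "0 < h" "h \<le> h0" "h \<le> 1" "z \<in> S" "norm u = 1" "norm v = 1" "fst u = 0" "fst v = 0" for h z u v
      using A(3) [of h z u v] pts [of h z] that by (simp add: Upsilon_eq_verlet)
    show "\<exists>P11 P12 P21 P22.
        (\<forall>h. 0 < h \<and> h \<le> h0 \<longrightarrow> (\<forall>z\<in>S. ?U h differentiable (at z) \<and>
          transpose (phase_jacobian (?U h) z) ** J_mat ** phase_jacobian (?U h) z
          = J_mat + block_mat (P11 h z) (P12 h z) (P21 h z) (P22 h z))) \<and>
        order_with C S h0 (min M1 M2 + 1) P11 \<and> order_with C S h0 (min M1 M2 + 1) P12 \<and>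
        order_with C S h0 (min M1 M2 + 1) P21 \<and> order_with C S h0 (M2 + 1) P22"
      by (rule exI [of _ "\<lambda>h. defect_block q_dir q_dir (?U h)"], rule exI [of _ "\<lambda>h. defect_block q_dir p_dir (?U h)"],
          rule exI [of _ "\<lambda>h. defect_block p_dir q_dir (?U h)"], rule exI [of _ "\<lambda>h. defect_block p_dir p_dir (?U h)"],
          intro conjI allI impI ballI order_with_defect_block [OF _ C(1)] jacobian_defect_blocks defect defect_p diff)
        (simp_all add: unit)
  next
    fix S :: "'n phase set" and h0 :: real
    assume adm: "Lambda_admissible D H M1 M2 S h0"
    have pts: "verlet_points_in (prod.swap ` D) (dual_field ?G) M1 M2 h (prod.swap z)"
      if "0 < h" "h \<le> h0" "z \<in> S" for h z
      using adm that by (rule Lambda_admissible_imp_verlet_points_in)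
    have diff: "?L h differentiable (at z)" if "0 < h" "h \<le> h0" "z \<in> S" for h z
      unfolding Lambda_eq_verlet
      by (intro swap_conj_differentiable dual.verlet_differentiable pts that)
    have swap: "symplectic_defect (?L h) z u v = - symplectic_defect (?V h) (prod.swap z) (prod.swap u) (prod.swap v)"
      if "0 < h" "h \<le> h0" "z \<in> S" for h z u v
      unfolding Lambda_eq_verlet
      by (intro symplectic_defect_swap_conj dual.verlet_differentiable pts that)
    have defect: "\<bar>symplectic_defect (?L h) z u v\<bar> \<le> B * h ^ (min M1 M2 + 1)"
      if "0 < h" "h \<le> h0" "h \<le> 1" "z \<in> S" "norm u = 1" "norm v = 1" for h z u v
      using B(2) [of h "prod.swap z" "prod.swap u" "prod.swap v"] pts [of h z] that by (simp add: swap)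
    have defect_q: "\<bar>symplectic_defect (?L h) z u v\<bar> \<le> B * h ^ (M2 + 1)"
      if "0 < h" "h \<le> h0" "h \<le> 1" "z \<in> S" "norm u = 1" "norm v = 1" "snd u = 0" "snd v = 0" for h z u v
      using B(3) [of h "prod.swap z" "prod.swap u" "prod.swap v"] pts [of h z] that by (simp add: swap)
    show "\<exists>P11 P12 P21 P22.
        (\<forall>h. 0 < h \<and> h \<le> h0 \<longrightarrow> (\<forall>z\<in>S. ?L h differentiable (at z) \<and>
          transpose (phase_jacobian (?L h) z) ** J_mat ** phase_jacobian (?L h) z
          = J_mat + block_mat (P11 h z) (P12 h z) (P21 h z) (P22 h z))) \<and>
        order_with C S h0 (M2 + 1) P11 \<and> order_with C S h0 (min M1 M2 + 1) P12 \<and>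
        order_with C S h0 (min M1 M2 + 1) P21 \<and> order_with C S h0 (min M1 M2 + 1) P22"
      by (rule exI [of _ "\<lambda>h. defect_block q_dir q_dir (?L h)"], rule exI [of _ "\<lambda>h. defect_block q_dir p_dir (?L h)"],
          rule exI [of _ "\<lambda>h. defect_block p_dir q_dir (?L h)"], rule exI [of _ "\<lambda>h. defect_block p_dir p_dir (?L h)"],
          intro conjI allI impI ballI order_with_defect_block [OF _ C(2)] jacobian_defect_blocks defect_q defect diff)
        (simp_all add: unit)
  qed
qed

end
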